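(* Let $\mathcal{A}$ be a unital $C^*$-algebra, let $n$ be a positive integer, and let $\Phi:\mathcal{A}\to\mathbb{M}_n$ be a positive linear map which is sub-unital, i.e. $\Phi(I)\le I$. Let $A\ge 0$ in $\mathcal{A}$ and let $p,q,r\ge 0$ be real numbers with $q\ge p$ and $q\ge r$. Then there exist unitaries $U,V\in\mathbb{M}_n$ such that $$|\Phi(A^p)\Phi(A^q)\Phi(A^r)|\le \frac{U\Phi(A^{p+q+r})U^*+V\Phi(A^{p+q+r})V^*}{2}.$$
   Context: $\mathbb{M}_n$ is the algebra of $n\times n$ complex matrices. Units are denoted by $I$. A linear map is positive if it maps positive elements to positive elements (positive semidefinite matrices in the case of $\mathbb{M}_n$). $|X|=(X^*X)^{1/2}$. Powers of positive elements are defined by functional calculus, with $A^0=I$. *)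

theory Defs
  imports "HOL-Analysis.Analysis"
begin

section \<open>Unital C*-algebras\<close>

text \<open>
  The class builds on \<^class>\<open>real_normed_algebra\<close> and \<^class>\<open>monoid_mult\<close> rather than on
  \<^class>\<open>real_normed_algebra_1\<close>, whose axiom that the unit has norm 1 would exclude the zero algebra.
\<close>

class cstar_algebra = banach + real_normed_algebra + monoid_mult +
  fixes scaleC :: "complex \<Rightarrow> 'a \<Rightarrow> 'a"  (infixr \<open>*\<^sub>C\<close> 75)
    and star :: "'a \<Rightarrow> 'a"
  assumes scaleC_add_right: "c *\<^sub>C (x + y) = c *\<^sub>C x + c *\<^sub>C y"
    and scaleC_add_left: "(c + d) *\<^sub>C x = c *\<^sub>C x + d *\<^sub>C x"
    and scaleC_scaleC: "c *\<^sub>C d *\<^sub>C x = (c * d) *\<^sub>C x"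
    and scaleC_of_real: "complex_of_real r *\<^sub>C x = r *\<^sub>R x"
    and scaleC_mult_left: "(c *\<^sub>C x) * y = c *\<^sub>C (x * y)"
    and scaleC_mult_right: "x * (c *\<^sub>C y) = c *\<^sub>C (x * y)"
    and norm_scaleC: "norm (c *\<^sub>C x) = cmod c * norm x"
    and star_add: "star (x + y) = star x + star y"
    and star_scaleC: "star (c *\<^sub>C x) = cnj c *\<^sub>C star x"
    and star_mult: "star (x * y) = star y * star x"
    and star_star: "star (star x) = x"
    and norm_star_mult_self: "norm (star x * x) = (norm x)\<^sup>2"

lemma vector_space_scaleC: "vector_space (scaleC :: complex \<Rightarrow> 'a \<Rightarrow> 'a::cstar_algebra)"
proof
  fix x :: 'a
  show "1 *\<^sub>C x = x"
    using scaleC_of_real[of 1 x] by simp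
qed (simp_all add: scaleC_add_right scaleC_add_left scaleC_scaleC)

instantiation complex :: cstar_algebra
begin

definition scaleC_complex :: "complex \<Rightarrow> complex \<Rightarrow> complex" where
  "scaleC_complex c x = c * x"

definition star_complex :: "complex \<Rightarrow> complex" where
  "star_complex x = cnj x"

instance
  by standard
    (simp_all add: scaleC_complex_def star_complex_def algebra_simps norm_mult power2_eq_square
      scaleR_conv_of_real)

end

definition spectrum :: "'a::cstar_algebra \<Rightarrow> complex set" where
  "spectrum a = {z. \<not> (\<exists>b. b * (a - z *\<^sub>C 1) = 1 \<and> (a - z *\<^sub>C 1) * b = 1)}"

definition cstar_positive :: "'a::cstar_algebra \<Rightarrow> bool" where
  "cstar_positive a \<longleftrightarrow> star a = a \<and> spectrum a \<subseteq> \<real>\<^sub>\<ge>\<^sub>0"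

text \<open>
  The continuous functional calculus at a normal element \<open>a\<close>: the unital *-homomorphism from the
  algebra of continuous complex functions on the spectrum \<open>S\<close> of \<open>a\<close> to the C*-algebra which sends
  the identity function to \<open>a\<close>. A continuous function on \<open>S\<close> is represented by any function on
  \<open>\<complex>\<close> extending it; the first condition says that the choice of the extension is irrelevant.
\<close>

definition is_functional_calculus ::
    "'a::cstar_algebra \<Rightarrow> ((complex \<Rightarrow> complex) \<Rightarrow> 'a) \<Rightarrow> bool" where
  "is_functional_calculus a \<pi> \<longleftrightarrow> (let S = spectrum a in
     (\<forall>f g. continuous_on S f \<longrightarrow> continuous_on S g \<longrightarrow> (\<forall>z\<in>S. f z = g z) \<longrightarrow> \<pi> f = \<pi> g) \<and>
     (\<forall>f g. continuous_on S f \<longrightarrow> continuous_on S g \<longrightarrow> \<pi> (\<lambda>z. f z + g z) = \<pi> f + \<pi> g) \<and>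
     (\<forall>f g. continuous_on S f \<longrightarrow> continuous_on S g \<longrightarrow> \<pi> (\<lambda>z. f z * g z) = \<pi> f * \<pi> g) \<and>
     (\<forall>c f. continuous_on S f \<longrightarrow> \<pi> (\<lambda>z. c * f z) = c *\<^sub>C \<pi> f) \<and>
     (\<forall>f. continuous_on S f \<longrightarrow> \<pi> (\<lambda>z. cnj (f z)) = star (\<pi> f)) \<and>
     \<pi> (\<lambda>z. 1) = 1 \<and>
     \<pi> (\<lambda>z. z) = a)"

definition cfc :: "(complex \<Rightarrow> complex) \<Rightarrow> 'a::cstar_algebra \<Rightarrow> 'a" where
  "cfc f a = (THE b. \<exists>\<pi>. is_functional_calculus a \<pi> \<and> \<pi> f = b)"

text \<open>
  The function \<open>x \<mapsto> x\<^sup>p\<close> on the nonnegative reals with \<open>0\<^sup>0 = 1\<close>, whereas \<open>0 powr 0 = 0\<close>.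
\<close>

definition nonneg_powr :: "real \<Rightarrow> real \<Rightarrow> real" where
  "nonneg_powr p x = (if p = 0 then 1 else x powr p)"

definition cstar_powr :: "'a::cstar_algebra \<Rightarrow> real \<Rightarrow> 'a" where
  "cstar_powr a p = cfc (\<lambda>z. complex_of_real (nonneg_powr p (Re z))) a"


section \<open>Complex matrices\<close>

definition mat_scale :: "complex \<Rightarrow> complex^'n^'m \<Rightarrow> complex^'n^'m" where
  "mat_scale c M = (\<chi> i j. c * M $ i $ j)"

lemma vector_space_mat_scale: "vector_space (mat_scale :: complex \<Rightarrow> complex^'n^'m \<Rightarrow> complex^'n^'m)"
  by standard (simp_all add: mat_scale_def vec_eq_iff algebra_simps)

definition conj_transpose :: "complex^'n^'m \<Rightarrow> complex^'m^'n" where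
  "conj_transpose M = (\<chi> i j. cnj (M $ j $ i))"

definition unitary :: "complex^'n^'n \<Rightarrow> bool" where
  "unitary U \<longleftrightarrow> conj_transpose U ** U = mat 1 \<and> U ** conj_transpose U = mat 1"

definition psd :: "complex^'n^'n \<Rightarrow> bool" where
  "psd M \<longleftrightarrow> conj_transpose M = M \<and> (\<forall>x. 0 \<le> Re (\<Sum>i\<in>UNIV. cnj (x $ i) * (M *v x) $ i))"

definition loewner_le :: "complex^'n^'n \<Rightarrow> complex^'n^'n \<Rightarrow> bool"  (infix \<open>\<preceq>\<close> 50) where
  "X \<preceq> Y \<longleftrightarrow> psd (Y - X)"

definition real_diag :: "('n \<Rightarrow> real) \<Rightarrow> complex^'n^'n" where
  "real_diag d = (\<chi> i j. if i = j then complex_of_real (d i) else 0)"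

text \<open>
  Functional calculus of a Hermitian matrix: apply \<open>f\<close> to the eigenvalues in a unitary
  diagonalization. The result does not depend on the diagonalization.
\<close>

definition mat_fun :: "(real \<Rightarrow> real) \<Rightarrow> complex^'n^'n \<Rightarrow> complex^'n^'n" where
  "mat_fun f M = (THE B. \<exists>U d. unitary U \<and> M = U ** real_diag d ** conj_transpose U
                             \<and> B = U ** real_diag (f \<circ> d) ** conj_transpose U)"

definition mat_powr :: "complex^'n^'n \<Rightarrow> real \<Rightarrow> complex^'n^'n" where
  "mat_powr M p = mat_fun (nonneg_powr p) M"

definition mat_abs :: "complex^'n^'n \<Rightarrow> complex^'n^'n" where
  "mat_abs X = mat_powr (conj_transpose X ** X) (1/2)"


section \<open>Positive linear maps\<close>

definition positive_linear_map :: "('a::cstar_algebra \<Rightarrow> complex^'n^'n) \<Rightarrow> bool" where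
  "positive_linear_map \<Phi> \<longleftrightarrow>
     Vector_Spaces.linear scaleC mat_scale \<Phi> \<and> (\<forall>a. cstar_positive a \<longrightarrow> psd (\<Phi> a))"

definition sub_unital :: "('a::cstar_algebra \<Rightarrow> complex^'n^'n) \<Rightarrow> bool" where
  "sub_unital \<Phi> \<longleftrightarrow> \<Phi> 1 \<preceq> mat 1"

end

theory Submission
  imports Defs "HOL-Computational_Algebra.Fundamental_Theorem_Algebra"
begin

text \<open>
  Write \<open>P, Q, R, H\<close> for the images of \<open>A\<^sup>p, A\<^sup>q, A\<^sup>r, A\<^sup>p\<^sup>+\<^sup>q\<^sup>+\<^sup>r\<close>, and let \<open>\<alpha> = p/q\<close>, \<open>\<beta> = r/q\<close>,
  \<open>s = 1 + \<beta> - \<alpha>\<close> and \<open>m = 1 + \<alpha> + \<beta>\<close>, with \<open>\<alpha> = \<beta> = 0\<close> if \<open>q = 0\<close>. With the polar decomposition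
  \<open>PQR = W |PQR|\<close> and the factorization of \<open>PQR\<close> into \<open>P Q\<^bsup>s/2\<^esup>\<close> and \<open>Q\<^bsup>1-s/2\<^esup> R\<close> one gets
  \<open>2 |PQR| \<le> W\<^sup>* P Q\<^sup>s P W + R Q\<^bsup>2-s\<^esup> R\<close>. It then suffices that the ordered eigenvalues of \<open>P Q\<^sup>s P\<close> and
  \<open>R Q\<^bsup>2-s\<^esup> R\<close> are dominated by those of \<open>H\<close>.

  For \<open>c > 0\<close> both are compared with the eigenvalues of \<open>Q\<close>. Let \<open>w = Px\<close> be orthogonal to the
  eigenvectors of \<open>Q\<close> with eigenvalue \<open>> c\<close>. The scalar inequality \<open>y\<^sup>\<alpha> \<le> \<alpha> y + 1 - \<alpha>\<close>, transported by
  positivity of the map, gives \<open>\<langle>Pw, w\<rangle> \<le> c\<^sup>\<alpha> |w|\<^sup>2\<close>, hence \<open>|w| \<le> c\<^sup>\<alpha> |x|\<close> by the Cauchy-Schwarz inequality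
  for the form of \<open>P\<close>, and so \<open>\<langle>P Q\<^sup>s P x, x\<rangle> \<le> c\<^bsup>s + 2\<alpha>\<^esup> |x|\<^sup>2 = c\<^sup>m |x|\<^sup>2\<close>. Dually \<open>y\<^sup>m \<ge> 1 + m (y - 1)\<close>
  shows that \<open>\<langle>Hx, x\<rangle> \<le> c\<^sup>m |x|\<^sup>2\<close> forces \<open>\<langle>Qx, x\<rangle> \<le> c |x|\<^sup>2\<close>.
\<close>

section \<open>Counting lemmas\<close>

text \<open>Gaussian elimination by induction on the equations: an equation with a nonzero
  coefficient at \<open>j\<close> is solved for \<open>x j\<close> and substituted into the others,
  which leaves one equation and one unknown less.\<close>

lemma homogeneous_system_nontrivial:
  fixes b :: "'k \<Rightarrow> 'i \<Rightarrow> 'f::field"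
  assumes "finite K" "finite I" "card K < card I"
  shows "\<exists>x. (\<exists>i\<in>I. x i \<noteq> 0) \<and> (\<forall>k\<in>K. (\<Sum>i\<in>I. b k i * x i) = 0)"
  using assms
proof (induction K arbitrary: I b rule: finite_induct)
  case empty
  then show ?case by (intro exI[of _ "\<lambda>_. 1"]) (auto simp: card_gt_0_iff)
next
  case (insert k K)
  show ?case
  proof (cases "\<forall>i\<in>I. b k i = 0")
    case True
    have "card K < card I" using insert by simp
    from insert.IH[OF insert.prems(1) this] obtain x
      where "\<exists>i\<in>I. x i \<noteq> 0" "\<forall>k\<in>K. (\<Sum>i\<in>I. b k i * x i) = 0" by blast
    then show ?thesis using True by (intro exI[of _ x]) auto
  next
    case False
    then obtain j where j: "j \<in> I" "b k j \<noteq> 0" by blast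
    let ?I = "I - {j}"
    have "card K < card ?I" using insert j by simp
    from insert.IH[OF _ this, where b = "\<lambda>l i. b l i - b l j * b k i / b k j"] insert.prems
    obtain x where x: "\<exists>i\<in>?I. x i \<noteq> 0"
      "\<forall>l\<in>K. (\<Sum>i\<in>?I. (b l i - b l j * b k i / b k j) * x i) = 0" by auto
    define s where "s = (\<Sum>i\<in>?I. b k i * x i)"
    define y where "y = x(j := - s / b k j)"
    have split: "(\<Sum>i\<in>I. b l i * y i) = b l j * y j + (\<Sum>i\<in>?I. b l i * x i)" for l
    proof -
      have "(\<Sum>i\<in>I. b l i * y i) = b l j * y j + (\<Sum>i\<in>?I. b l i * y i)"
        using j insert.prems by (intro sum.remove)
      also have "(\<Sum>i\<in>?I. b l i * y i) = (\<Sum>i\<in>?I. b l i * x i)"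
        by (intro sum.cong) (auto simp: y_def)
      finally show ?thesis .
    qed
    have "(\<Sum>i\<in>I. b l i * y i) = 0" if "l \<in> K" for l
    proof -
      have "0 = (\<Sum>i\<in>?I. b l i * x i - b l j / b k j * (b k i * x i))"
        using x(2) that by (simp add: left_diff_distrib mult.assoc)
      also have "\<dots> = (\<Sum>i\<in>?I. b l i * x i) - b l j / b k j * s"
        by (simp add: sum_subtractf sum_distrib_left s_def)
      finally show ?thesis unfolding split by (simp add: y_def)
    qed
    moreover have "(\<Sum>i\<in>I. b k i * y i) = 0"
      unfolding split using j by (simp add: y_def s_def)
    moreover have "\<exists>i\<in>I. y i \<noteq> 0" using x(1) by (auto simp: y_def)
    ultimately show ?thesis by (intro exI[of _ y]) auto
  qed
qed

text \<open>Greedy matching: a maximizer of \<open>f\<close> is paired with a maximizer of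
  \<open>g\<close>, and the remaining elements by induction. Since \<open>g\<close> is nonnegative,
  positive thresholds carry enough information.\<close>

lemma domination_bijection:
  fixes f :: "'i \<Rightarrow> real" and g :: "'j \<Rightarrow> real"
  assumes "finite A" "finite B" "card A = card B" "\<And>j. j \<in> B \<Longrightarrow> 0 \<le> g j"
    and "\<And>c. 0 < c \<Longrightarrow> card {i\<in>A. c < f i} \<le> card {j\<in>B. c < g j}"
  shows "\<exists>\<pi>. bij_betw \<pi> A B \<and> (\<forall>i\<in>A. f i \<le> g (\<pi> i))"
  using assms
proof (induction "card A" arbitrary: A B)
  case 0
  then show ?case by (auto simp: bij_betw_def)
next
  case (Suc n)
  then have ne: "A \<noteq> {}" "B \<noteq> {}" by auto
  obtain a where a: "a \<in> A" "\<And>i. i \<in> A \<Longrightarrow> f i \<le> f a"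
  proof -
    have "Max (f ` A) \<in> f ` A" using Suc(3) ne by (intro Max_in) auto
    then obtain a where "a \<in> A" "f a = Max (f ` A)" by auto
    then show ?thesis using that Suc(3) by (metis Max_ge finite_imageI imageI)
  qed
  obtain b where b: "b \<in> B" "\<And>i. i \<in> B \<Longrightarrow> g i \<le> g b"
  proof -
    have "Max (g ` B) \<in> g ` B" using Suc(4) ne by (intro Max_in) auto
    then obtain b where "b \<in> B" "g b = Max (g ` B)" by auto
    then show ?thesis using that Suc(4) by (metis Max_ge finite_imageI imageI)
  qed
  have fa: "f a \<le> g b"
  proof (rule ccontr)
    assume "\<not> f a \<le> g b"
    \<comment> \<open>If \<open>f a\<close> exceeded \<open>g b\<close>, the midpoint would be a
      positive threshold that counts \<open>a\<close> but no element of \<open>B\<close>.\<close>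
    define c where "c = (f a + g b) / 2"
    have c: "g b < c" "c < f a" "0 < c"
      using \<open>\<not> f a \<le> g b\<close> Suc(6)[OF b(1)] by (auto simp: c_def)
    have "{j\<in>B. c < g j} = {}" using b c by force
    then have "card {j\<in>B. c < g j} = 0" by (simp only: card.empty)
    moreover have "card {i\<in>A. c < f i} > 0" using a c Suc(3) by (auto simp: card_gt_0_iff)
    ultimately show False using Suc(7)[OF c(3)] by linarith
  qed
  have "\<exists>\<pi>. bij_betw \<pi> (A - {a}) (B - {b}) \<and> (\<forall>i\<in>A - {a}. f i \<le> g (\<pi> i))"
  proof (rule Suc(1))
    fix c :: real assume c: "0 < c"
    show "card {i \<in> A - {a}. c < f i} \<le> card {j \<in> B - {b}. c < g j}"
    \<comment> \<open>For \<open>c < f a\<close> both counts drop by one when \<open>a\<close> and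
      \<open>b\<close> are removed; otherwise the left count is zero.\<close>
    proof (cases "c < f a")
      case True
      have "{i\<in>A. c < f i} = insert a {i \<in> A - {a}. c < f i}"
        "{j\<in>B. c < g j} = insert b {j \<in> B - {b}. c < g j}"
        using True a b fa by auto
      with Suc(7)[OF c] show ?thesis using Suc(3,4) by simp
    next
      case False
      then have "{i \<in> A - {a}. c < f i} = {}" using a by force
      then show ?thesis by (simp only: card.empty)
    qed
  qed (use Suc a b in auto)
  then obtain \<pi> where \<pi>: "bij_betw \<pi> (A - {a}) (B - {b})" "\<forall>i\<in>A - {a}. f i \<le> g (\<pi> i)" by blast
  have "bij_betw (\<pi>(a := b)) (insert a (A - {a})) (insert b (B - {b}))"
  proof -
    have "bij_betw (\<pi>(a := b)) (A - {a}) (B - {b})"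
      using \<pi>(1) by (rule bij_betw_cong[THEN iffD1, rotated]) auto
    then show ?thesis using notIn_Un_bij_betw[of a "A - {a}" "\<pi>(a := b)" "B - {b}"] by simp
  qed
  then have "bij_betw (\<pi>(a := b)) A B" using a b by (simp add: insert_absorb)
  then show ?case using \<pi>(2) fa by (intro exI[of _ "\<pi>(a := b)"]) auto
qed

section \<open>Hermitian matrices\<close>

lemma inner_complex_conv: "inner x y = Re (cnj x * y)" for x y :: complex
  by (simp add: inner_complex_def)

lemma conj_transpose_nth [simp]: "conj_transpose M $ i $ j = cnj (M $ j $ i)"
  by (simp add: conj_transpose_def)

lemma conj_transpose_conj_transpose [simp]: "conj_transpose (conj_transpose M) = M"
  by (simp add: vec_eq_iff)

lemma conj_transpose_mult:
  "conj_transpose (A ** B) = conj_transpose B ** conj_transpose A"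
  by (simp add: vec_eq_iff matrix_matrix_mult_def mult.commute)

lemma conj_transpose_add: "conj_transpose (A + B) = conj_transpose A + conj_transpose B"
  by (simp add: vec_eq_iff)

lemma conj_transpose_diff: "conj_transpose (A - B) = conj_transpose A - conj_transpose B"
  by (simp add: vec_eq_iff)

lemma conj_transpose_scaleR: "conj_transpose (c *\<^sub>R A) = c *\<^sub>R conj_transpose A"
  by (simp add: vec_eq_iff)

lemma conj_transpose_real_diag [simp]: "conj_transpose (real_diag d) = real_diag d"
  by (simp add: vec_eq_iff real_diag_def)

lemma norm_power2_vec: "(norm (x :: complex^'n))\<^sup>2 = (\<Sum>i\<in>UNIV. (norm (x $ i))\<^sup>2)"
  by (simp add: norm_vec_def L2_set_def sum_nonneg)

text \<open>The real inner product \<bullet> is the real part of this form. It suffices for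
  quadratic forms of Hermitian matrices, whereas orthogonality over the complex numbers also
  involves the imaginary part.\<close>

definition cinner :: "complex^'n \<Rightarrow> complex^'n \<Rightarrow> complex" where
  "cinner x y = (\<Sum>i\<in>UNIV. cnj (x $ i) * y $ i)"

lemma Re_cinner: "Re (cinner x y) = x \<bullet> y"
  by (simp only: cinner_def Re_sum inner_vec_def inner_complex_conv)

lemma cinner_commute: "cinner y x = cnj (cinner x y)"
  by (simp add: cinner_def mult.commute)

lemma cinner_self: "cinner x x = complex_of_real ((norm x)\<^sup>2)"
  by (simp add: cinner_def norm_power2_vec complex_norm_square mult.commute del: of_real_power)

lemma cinner_adjoint: "cinner x (M *v y) = cinner (conj_transpose M *v x) y"
proof -
  have "cinner x (M *v y) = (\<Sum>i\<in>UNIV. \<Sum>j\<in>UNIV. cnj (x $ i) * (M $ i $ j * y $ j))"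
    by (simp only: cinner_def matrix_vector_mult_def vec_lambda_beta sum_distrib_left)
  also have "\<dots> = (\<Sum>j\<in>UNIV. \<Sum>i\<in>UNIV. cnj (x $ i) * (M $ i $ j * y $ j))"
    by (rule sum.swap)
  also have "\<dots> = cinner (conj_transpose M *v x) y"
    by (simp only: cinner_def matrix_vector_mult_def sum_distrib_right
        vec_lambda_beta cnj_sum complex_cnj_mult complex_cnj_cnj conj_transpose_nth)
      (simp only: mult_ac)
  finally show ?thesis .
qed

lemma inner_matrix_vector_adjoint:
  fixes M :: "complex^'n^'m"
  shows "x \<bullet> (M *v y) = (conj_transpose M *v x) \<bullet> y"
  by (simp only: cinner_adjoint flip: Re_cinner)

lemma psd_iff: "psd M \<longleftrightarrow> conj_transpose M = M \<and> (\<forall>x. 0 \<le> x \<bullet> (M *v x))"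
  by (simp only: psd_def inner_vec_def inner_complex_conv Re_sum)

lemma loewner_le_iff:
  assumes "conj_transpose A = A" "conj_transpose B = B"
  shows "A \<preceq> B \<longleftrightarrow> (\<forall>x. x \<bullet> (A *v x) \<le> x \<bullet> (B *v x))"
  using assms by (simp add: loewner_le_def psd_iff conj_transpose_diff
      matrix_vector_mult_diff_rdistrib inner_diff_right)

section \<open>Unitary matrices and quadratic forms in an eigenbasis\<close>

lemma inner_congruence:
  fixes M :: "complex^'n^'n"
  shows "x \<bullet> ((U ** M ** conj_transpose U) *v x) =
    (conj_transpose U *v x) \<bullet> (M *v (conj_transpose U *v x))"
  by (simp add: inner_matrix_vector_adjoint[of x U] flip: matrix_vector_mul_assoc)

lemma norm_unitary_apply:
  assumes "unitary U" shows "norm (conj_transpose U *v x) = norm x"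
proof -
  have "(conj_transpose U *v x) \<bullet> (conj_transpose U *v x) = x \<bullet> x"
    using inner_congruence[of x U "mat 1"] assms
    by (simp add: unitary_def)
  then show ?thesis by (simp add: norm_eq_sqrt_inner)
qed

lemma unitary_mult: "unitary U \<Longrightarrow> unitary V \<Longrightarrow> unitary (U ** V)"
  unfolding unitary_def conj_transpose_mult
  by (metis matrix_mul_assoc matrix_mul_rid)

lemma unitary_conj_transpose: "unitary U \<Longrightarrow> unitary (conj_transpose U)"
  by (simp add: unitary_def)

lemma real_diag_apply: "(real_diag d *v x) $ i = complex_of_real (d i) * x $ i"
  by (simp add: real_diag_def matrix_vector_mult_def if_distrib if_distribR cong: if_cong)

lemma inner_diagonalized:
  assumes "M = U ** real_diag d ** conj_transpose U"
  shows "x \<bullet> (M *v x) = (\<Sum>i\<in>UNIV. d i * (norm ((conj_transpose U *v x) $ i))\<^sup>2)"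
proof -
  have *: "inner z (complex_of_real t * z) = t * (norm z)\<^sup>2" for t z
    unfolding cmod_power2 by (simp add: inner_complex_def power2_eq_square algebra_simps)
  show ?thesis unfolding assms inner_congruence
    by (simp only: inner_vec_def real_diag_apply *)
qed

text \<open>The last hypothesis places \<open>x\<close> in the span of the eigenvectors with
  eigenvalue at most \<open>c\<close>.\<close>

lemma diagonalized_le:
  assumes "unitary U" "M = U ** real_diag d ** conj_transpose U"
    and "\<And>i. (conj_transpose U *v x) $ i \<noteq> 0 \<Longrightarrow> d i \<le> c"
  shows "x \<bullet> (M *v x) \<le> c * (norm x)\<^sup>2"
proof -
  have "x \<bullet> (M *v x) \<le> (\<Sum>i\<in>UNIV. c * (norm ((conj_transpose U *v x) $ i))\<^sup>2)"
    unfolding inner_diagonalized[OF assms(2)] using assms(3)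
    by (intro sum_mono) (metis mult_right_mono mult_zero_right norm_zero order_refl power_zero_numeral zero_le_power2)
  also have "\<dots> = c * (norm (conj_transpose U *v x))\<^sup>2"
    by (simp only: norm_power2_vec sum_distrib_left)
  finally show ?thesis using norm_unitary_apply[OF assms(1)] by simp
qed

lemma diagonalized_gt:
  assumes "unitary U" "M = U ** real_diag d ** conj_transpose U" "x \<noteq> 0"
    and "\<And>i. (conj_transpose U *v x) $ i \<noteq> 0 \<Longrightarrow> c < d i"
  shows "c * (norm x)\<^sup>2 < x \<bullet> (M *v x)"
proof -
  let ?y = "conj_transpose U *v x"
  have "norm ?y \<noteq> 0" using norm_unitary_apply[OF assms(1), of x] assms(3) by simp
  \<comment> \<open>A nonzero coordinate of \<open>x\<close> in the eigenbasis makes the inequality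
    strict.\<close>
  then obtain j where j: "?y $ j \<noteq> 0" by (auto simp: vec_eq_iff)
  have "c * (norm ?y)\<^sup>2 = (\<Sum>i\<in>UNIV. c * (norm (?y $ i))\<^sup>2)"
    by (simp only: norm_power2_vec sum_distrib_left)
  also have "\<dots> < (\<Sum>i\<in>UNIV. d i * (norm (?y $ i))\<^sup>2)"
  proof (rule sum_strict_mono_ex1)
    show "\<forall>i\<in>UNIV. c * (norm (?y $ i))\<^sup>2 \<le> d i * (norm (?y $ i))\<^sup>2"
      using assms(4) by (metis mult_right_mono mult_zero_right norm_zero order_refl power_zero_numeral zero_le_power2 less_imp_le)
    show "\<exists>i\<in>UNIV. c * (norm (?y $ i))\<^sup>2 < d i * (norm (?y $ i))\<^sup>2"
      using assms(4)[OF j] j by (intro bexI[of _ j]) auto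
  qed simp
  finally show ?thesis
    unfolding inner_diagonalized[OF assms(2)] norm_unitary_apply[OF assms(1)] .
qed

section \<open>Orthonormal systems and the spectral theorem\<close>

lemma cinner_scaleR_right: "cinner x (c *\<^sub>R y) = of_real c * cinner x y"
  by (simp add: cinner_def sum_distrib_left scaleR_conv_of_real[where 'a = complex] algebra_simps)

lemma cinner_scaleR_left: "cinner (c *\<^sub>R x) y = of_real c * cinner x y"
  by (simp add: cinner_def sum_distrib_left scaleR_conv_of_real[where 'a = complex] algebra_simps)

lemma cinner_diff_right: "cinner x (y - z) = cinner x y - cinner x z"
  by (simp add: cinner_def sum_subtractf algebra_simps)

definition orthonormal_on :: "'i set \<Rightarrow> ('i \<Rightarrow> complex^'n) \<Rightarrow> bool" where
  "orthonormal_on J u \<longleftrightarrow> (\<forall>i\<in>J. \<forall>j\<in>J. cinner (u i) (u j) = (if i = j then 1 else 0))"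

text \<open>Orthogonality to the vectors of a proper subfamily is a homogeneous system with fewer
  equations than unknowns.\<close>

lemma exists_orthogonal:
  fixes u :: "'n \<Rightarrow> complex^'n"
  assumes "J \<noteq> UNIV"
  shows "\<exists>v. norm v = 1 \<and> (\<forall>j\<in>J. cinner (u j) v = 0)"
proof -
  have "card J < card (UNIV :: 'n set)" using assms by (simp add: psubset_card_mono psubset_eq)
  from homogeneous_system_nontrivial[OF _ _ this, where b = "\<lambda>j i. cnj (u j $ i)"]
  obtain x where x: "\<exists>i. x i \<noteq> 0" "\<forall>j\<in>J. (\<Sum>i\<in>UNIV. cnj (u j $ i) * x i) = 0" by auto
  define y :: "complex^'n" where "y = (\<chi> i. x i)"
  have "y \<noteq> 0" using x(1) by (auto simp: y_def vec_eq_iff)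
  moreover have "\<forall>j\<in>J. cinner (u j) y = 0" using x(2) by (simp add: cinner_def y_def)
  ultimately show ?thesis
    by (intro exI[of _ "(1 / norm y) *\<^sub>R y"]) (simp add: cinner_scaleR_right)
qed

lemma orthonormal_on_insert:
  assumes "orthonormal_on J u" "k \<notin> J" "norm v = 1" "\<forall>j\<in>J. cinner (u j) v = 0"
  shows "orthonormal_on (insert k J) (u(k := v))"
proof -
  have "cinner v v = 1" using assms(3) by (simp add: cinner_self)
  moreover have "cinner v (u j) = 0" if "j \<in> J" for j
    using assms(4) that by (simp add: cinner_commute[of v])
  ultimately show ?thesis using assms unfolding orthonormal_on_def by auto
qed

lemma orthonormal_on_extend:
  fixes u :: "'n \<Rightarrow> complex^'n"
  assumes "orthonormal_on J u"
  shows "\<exists>u'. orthonormal_on UNIV u' \<and> (\<forall>j\<in>J. u' j = u j)"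
proof -
  have "\<exists>u'. orthonormal_on (J \<union> K) u' \<and> (\<forall>j\<in>J. u' j = u j)" if "K \<subseteq> UNIV - J" "finite K" for K
    using that(2,1)
  proof (induction K rule: finite_induct)
    case empty
    then show ?case using assms by auto
  next
    case (insert k K)
    then obtain u' where u': "orthonormal_on (J \<union> K) u'" "\<forall>j\<in>J. u' j = u j" by auto
    have "k \<notin> J \<union> K" using insert by auto
    moreover from this have "J \<union> K \<noteq> UNIV" by auto
    then obtain v where "norm v = 1" "\<forall>j\<in>J \<union> K. cinner (u' j) v = 0"
      using exists_orthogonal[of "J \<union> K" u'] by blast
    ultimately have "orthonormal_on (insert k (J \<union> K)) (u'(k := v))"
      using u' by (intro orthonormal_on_insert)
    then show ?case using u'(2) insert.prems by (intro exI[of _ "u'(k := v)"]) (auto simp: fun_upd_def)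
  qed
  from this[of "UNIV - J"] show ?thesis by simp
qed

definition matrix_of_columns :: "('m \<Rightarrow> complex^'n) \<Rightarrow> complex^'m^'n" where
  "matrix_of_columns u = (\<chi> i j. u j $ i)"

lemma unitary_matrix_of_columns:
  fixes u :: "'n \<Rightarrow> complex^'n"
  shows "unitary (matrix_of_columns u) \<longleftrightarrow> orthonormal_on UNIV u"
proof -
  have "conj_transpose (matrix_of_columns u) ** matrix_of_columns u = mat 1 \<longleftrightarrow> orthonormal_on UNIV u"
    by (simp add: vec_eq_iff matrix_matrix_mult_def matrix_of_columns_def orthonormal_on_def
        cinner_def mat_def)
  \<comment> \<open>For square matrices a left inverse is also a right inverse, so orthonormal
    columns give both equations.\<close>
  then show ?thesis
    unfolding unitary_def using matrix_left_right_inverse by blast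
qed

lemma mult_matrix_of_columns: "M ** matrix_of_columns u = matrix_of_columns (\<lambda>j. M *v u j)"
  by (simp add: vec_eq_iff matrix_matrix_mult_def matrix_vector_mult_def matrix_of_columns_def)

lemma matrix_of_columns_mult_real_diag:
  "matrix_of_columns u ** real_diag d = matrix_of_columns (\<lambda>j. d j *\<^sub>R u j)"
  by (simp add: vec_eq_iff matrix_matrix_mult_def real_diag_def matrix_of_columns_def
      scaleR_conv_of_real[where 'a = complex] if_distrib mult.commute cong: if_cong)

lemma matrix_of_columns_columns: "U = matrix_of_columns (\<lambda>j. column j U)"
  by (simp add: vec_eq_iff matrix_of_columns_def column_def)

text \<open>The eigenvector maximizes the Rayleigh quotient on the orthogonal complement.\<close>

lemma exists_orthogonal_eigenvector:
  fixes M :: "complex^'n^'n" and u :: "'n \<Rightarrow> complex^'n"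
  assumes "conj_transpose M = M" "J \<noteq> UNIV" "\<And>j. j \<in> J \<Longrightarrow> M *v u j = d j *\<^sub>R u j"
  shows "\<exists>v l. norm v = 1 \<and> (\<forall>j\<in>J. cinner (u j) v = 0) \<and> M *v v = (l :: real) *\<^sub>R v"
proof -
  let ?V = "{v. \<forall>j\<in>J. cinner (u j) v = 0}"
  have cont: "continuous_on UNIV (\<lambda>v. cinner (u j) v)" for j
    unfolding cinner_def by (intro continuous_intros)
  have "closed ?V"
  proof -
    have "?V = (\<Inter>j\<in>J. {v. cinner (u j) v = 0})" by auto
    moreover have "closed {v. cinner (u j) v = 0}" for j
      using closed_Collect_eq[OF cont continuous_on_const] .
    ultimately show ?thesis by auto
  qed
  then have "compact (sphere 0 1 \<inter> ?V)" by (intro compact_Int_closed) auto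
  moreover have "sphere 0 1 \<inter> ?V \<noteq> {}"
    using exists_orthogonal[OF assms(2), of u] by (auto simp: sphere_def dist_norm)
  moreover have "continuous_on (sphere 0 1 \<inter> ?V) (\<lambda>v. v \<bullet> (M *v v))"
    by (intro continuous_intros linear_continuous_on_compose[OF continuous_on_id]) auto
  ultimately have "\<exists>v\<in>sphere 0 1 \<inter> ?V. \<forall>y\<in>sphere 0 1 \<inter> ?V. y \<bullet> (M *v y) \<le> v \<bullet> (M *v v)"
    by (rule continuous_attains_sup)
  then obtain v where v: "v \<in> sphere 0 1 \<inter> ?V"
    "\<And>y. y \<in> sphere 0 1 \<inter> ?V \<Longrightarrow> y \<bullet> (M *v y) \<le> v \<bullet> (M *v v)"
    by blast
  define l where "l = v \<bullet> (M *v v)"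
  have nv: "norm v = 1" "v \<bullet> v = 1" using v(1) by (auto simp: norm_eq_1)
  have le: "y \<bullet> (M *v y) \<le> l * (norm y)\<^sup>2" if "y \<in> ?V" for y
  proof (cases "y = 0")
    case False
    let ?y = "(1 / norm y) *\<^sub>R y"
    have "?y \<bullet> (M *v ?y) \<le> l" unfolding l_def
      using that False by (intro v(2)) (auto simp: cinner_scaleR_right dist_norm)
    moreover have "M *v ?y = (1 / norm y) *\<^sub>R (M *v y)"
      by (simp add: linear_scale)
    ultimately show ?thesis using False by (simp add: field_simps power2_eq_square)
  qed simp
  \<comment> \<open>The residual \<open>w\<close> vanishes exactly when \<open>v\<close> is an
    eigenvector for \<open>l\<close>. Moving from \<open>v\<close> to \<open>v - t w\<close> changes
    the gap \<open>l |y|^2 - y \<bullet> M y\<close>, which is zero at \<open>v\<close> and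
    nonnegative on \<open>?V\<close>, by \<open>- 2 t |w|^2\<close> to first order; this forces
    \<open>w = 0\<close>.\<close>
  define w where "w = l *\<^sub>R v - M *v v"
  \<comment> \<open>The complement is invariant because \<open>M\<close> is self-adjoint and the
    \<open>u j\<close> are eigenvectors.\<close>
  have MV: "M *v y \<in> ?V" if "y \<in> ?V" for y
    using that assms by (simp add: cinner_adjoint cinner_scaleR_left)
  have wV: "w \<in> ?V" using v(1) MV[of v] by (simp add: w_def cinner_diff_right cinner_scaleR_right)
  define C where "C = l * (norm w)\<^sup>2 - w \<bullet> (M *v w)"
  have key: "2 * (norm w)\<^sup>2 \<le> t * C" if "0 < t" for t
  proof -
    have "v - t *\<^sub>R w \<in> ?V" using v(1) wV by (simp add: cinner_diff_right cinner_scaleR_right)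
    from le[OF this] have "0 \<le> l * ((v - t *\<^sub>R w) \<bullet> (v - t *\<^sub>R w)) - (v - t *\<^sub>R w) \<bullet> (M *v (v - t *\<^sub>R w))"
      by (simp add: dot_square_norm)
    also have "M *v (v - t *\<^sub>R w) = M *v v - t *\<^sub>R (M *v w)"
      by (simp add: linear_diff linear_scale)
    also have "l * ((v - t *\<^sub>R w) \<bullet> (v - t *\<^sub>R w)) - (v - t *\<^sub>R w) \<bullet> (M *v v - t *\<^sub>R (M *v w)) =
       - 2 * t * (w \<bullet> w) + t\<^sup>2 * C"
    proof -
      have "v \<bullet> (M *v w) = w \<bullet> (M *v v)"
        using inner_matrix_vector_adjoint[of v M w] assms(1) by (simp add: inner_commute)
      moreover have "v \<bullet> w = 0" "w \<bullet> v = 0"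
        using nv(2) by (simp_all add: w_def inner_diff_right inner_diff_left l_def inner_commute)
      moreover have "w \<bullet> (M *v v) = - (w \<bullet> w)"
        using \<open>w \<bullet> v = 0\<close> by (simp add: w_def inner_diff_right inner_diff_left inner_commute)
      moreover have "v \<bullet> (M *v v) = l" by (simp add: l_def)
      ultimately show ?thesis
        using nv(2) unfolding C_def power2_norm_eq_inner
        by (simp add: inner_diff_left inner_diff_right power2_eq_square algebra_simps)
    qed
    finally show ?thesis using that by (simp add: power2_eq_square dot_square_norm)
  qed
  have "(norm w)\<^sup>2 \<le> 0"
  proof (rule ccontr)
    assume "\<not> ?thesis"
    then have n: "0 < (norm w)\<^sup>2" by simp
    \<comment> \<open>\<open>t = 1\<close> shows \<open>C > 0\<close>, and then
      \<open>t = |w|^2 / C\<close> yields \<open>2 |w|^2 \<le> |w|^2\<close>.\<close>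
    with key[of 1] have "C > 0" by linarith
    then have "2 * (norm w)\<^sup>2 \<le> (norm w)\<^sup>2 / C * C"
      using n by (intro key divide_pos_pos)
    also have "\<dots> = (norm w)\<^sup>2" using \<open>C > 0\<close> by simp
    finally show False using n by linarith
  qed
  then have "M *v v = l *\<^sub>R v" by (simp add: w_def)
  then show ?thesis using v(1) nv by blast
qed

text \<open>Orthonormal eigenvectors are found one at a time, each in the orthogonal complement of
  the earlier ones; they become the columns of \<open>U\<close>.\<close>

lemma spectral_theorem:
  fixes M :: "complex^'n^'n"
  assumes "conj_transpose M = M"
  shows "\<exists>U d. unitary U \<and> M = U ** real_diag d ** conj_transpose U"
proof -
  have "\<exists>u d. orthonormal_on J u \<and> (\<forall>j\<in>J. M *v u j = (d j :: real) *\<^sub>R u j)" for J :: "'n set"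
    using finite[of J]
  proof (induction J rule: finite_induct)
    case empty
    then show ?case by (simp add: orthonormal_on_def)
  next
    case (insert k J)
    then obtain u d where u: "orthonormal_on J u" "\<forall>j\<in>J. M *v u j = (d j :: real) *\<^sub>R u j" by blast
    have "J \<noteq> UNIV" using insert by auto
    from exists_orthogonal_eigenvector[OF assms this, of u d] u(2)
    obtain v l where v: "norm v = 1" "\<forall>j\<in>J. cinner (u j) v = 0" "M *v v = (l :: real) *\<^sub>R v" by blast
    have "orthonormal_on (insert k J) (u(k := v))"
      using u(1) insert(2) v by (intro orthonormal_on_insert)
    moreover have "\<forall>j\<in>insert k J. M *v (u(k := v)) j = (d(k := l)) j *\<^sub>R (u(k := v)) j"
      using u(2) v(3) insert(2) by auto
    ultimately show ?case by blast
  qed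
  from this[of UNIV] obtain u :: "'n \<Rightarrow> complex^'n" and d where u: "orthonormal_on UNIV u"
    "\<forall>j. M *v u j = (d j :: real) *\<^sub>R u j" by fastforce
  let ?U = "matrix_of_columns u"
  have U: "unitary ?U" using u(1) by (simp add: unitary_matrix_of_columns)
  have "M ** ?U = ?U ** real_diag d"
    using u(2) by (simp add: mult_matrix_of_columns matrix_of_columns_mult_real_diag)
  then have "?U ** real_diag d ** conj_transpose ?U = M ** (?U ** conj_transpose ?U)"
    by (simp add: matrix_mul_assoc)
  also have "\<dots> = M" using U by (simp add: unitary_def)
  finally show ?thesis using U by metis
qed

text \<open>This makes the description in \<open>mat_fun\<close> independent of the diagonalization.
  The matrix \<open>W\<close> intertwines the two diagonal matrices, so a nonzero entry
  \<open>W $ i $ j\<close> forces \<open>d j = e i\<close>; hence \<open>W\<close> also intertwines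
  them after \<open>f\<close> is applied.\<close>

lemma mat_fun_diagonalized:
  fixes U :: "complex^'n^'n"
  assumes "unitary U" "M = U ** real_diag d ** conj_transpose U"
  shows "mat_fun f M = U ** real_diag (f \<circ> d) ** conj_transpose U"
  unfolding mat_fun_def
proof (rule the_equality)
  fix B
  assume "\<exists>V e. unitary V \<and> M = V ** real_diag e ** conj_transpose V \<and>
    B = V ** real_diag (f \<circ> e) ** conj_transpose V"
  then obtain V e where V: "unitary V" "M = V ** real_diag e ** conj_transpose V"
    "B = V ** real_diag (f \<circ> e) ** conj_transpose V" by blast
  define W where "W = conj_transpose V ** U"
  have VU: "V ** W = U" "W ** conj_transpose U = conj_transpose V"
    using V(1) assms(1) unfolding W_def unitary_def
    by (metis matrix_mul_assoc matrix_mul_lid, metis matrix_mul_assoc matrix_mul_rid)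
  have "W ** real_diag d = conj_transpose V ** M ** U"
    using assms unfolding W_def unitary_def by (metis matrix_mul_assoc matrix_mul_rid)
  also have "\<dots> = real_diag e ** W"
    using V unfolding W_def unitary_def by (metis matrix_mul_assoc matrix_mul_lid)
  finally have "W $ i $ j * d j = e i * W $ i $ j" for i j
    by (simp add: vec_eq_iff matrix_matrix_mult_def real_diag_def if_distrib if_distribR cong: if_cong)
  then have "W $ i $ j * f (d j) = f (e i) * W $ i $ j" for i j
    by (metis mult.commute mult_cancel_right of_real_eq_iff)
  then have "W ** real_diag (f \<circ> d) = real_diag (f \<circ> e) ** W"
    by (simp add: vec_eq_iff matrix_matrix_mult_def real_diag_def if_distrib if_distribR cong: if_cong)
  then show "B = U ** real_diag (f \<circ> d) ** conj_transpose U"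
    using V(3) VU by (metis matrix_mul_assoc)
qed (use assms in blast)

section \<open>Positive semidefinite matrices and the polar decomposition\<close>

lemma psd_gram: "psd (conj_transpose X ** X)"
  by (simp add: psd_iff conj_transpose_mult inner_matrix_vector_adjoint[of _ "conj_transpose X"]
      flip: matrix_vector_mul_assoc)

lemma psd_diagonalization:
  fixes M :: "complex^'n^'n"
  assumes "psd M"
  obtains U d where "unitary U" "M = U ** real_diag d ** conj_transpose U" "\<And>i. 0 \<le> d i"
proof -
  obtain U d where U: "unitary U" "M = U ** real_diag d ** conj_transpose U"
    using assms spectral_theorem unfolding psd_iff by blast
  have "0 \<le> d i" for i
  proof -
    let ?x = "U *v axis i 1"
    have "conj_transpose U *v ?x = axis i 1"
      using U(1) by (simp add: unitary_def matrix_vector_mul_assoc)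
    then have "?x \<bullet> (M *v ?x) = (\<Sum>j\<in>UNIV. d j * (norm ((axis i 1 :: complex^'n) $ j))\<^sup>2)"
      by (simp only: inner_diagonalized[OF U(2)])
    also have "\<dots> = (\<Sum>j\<in>UNIV. if j = i then d i else 0)"
      by (intro sum.cong) (auto simp: axis_def)
    also have "\<dots> = d i" by simp
    finally show ?thesis using assms unfolding psd_iff by metis
  qed
  with U that show ?thesis by blast
qed

lemma nonneg_powr_half: "0 \<le> x \<Longrightarrow> nonneg_powr (1 / 2) x = sqrt x"
  by (simp add: nonneg_powr_def powr_half_sqrt)

lemma conj_transpose_diagonalized:
  "conj_transpose (U ** real_diag d ** conj_transpose U) = U ** real_diag d ** conj_transpose U"
  by (simp add: conj_transpose_mult matrix_mul_assoc)

text \<open>\<open>X\<close> maps the eigenvectors \<open>v j\<close> of \<open>X^* X\<close> to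
  orthogonal vectors of length \<open>sqrt (d j)\<close>. The nonzero images are normalized and
  completed to an orthonormal basis \<open>u'\<close>, and \<open>W\<close> takes \<open>v j\<close>
  to \<open>u' j\<close>. The completion makes \<open>W\<close> unitary even for singular
  \<open>X\<close>.\<close>

lemma polar_decomposition:
  fixes X :: "complex^'n^'n"
  shows "\<exists>W. unitary W \<and> conj_transpose (mat_abs X) = mat_abs X \<and> X = W ** mat_abs X"
proof -
  obtain V d where V: "unitary V" "conj_transpose X ** X = V ** real_diag d ** conj_transpose V"
    and d: "\<And>i. 0 \<le> d i"
    using psd_diagonalization[OF psd_gram[of X]] by blast
  have abs: "mat_abs X = V ** real_diag (\<lambda>i. sqrt (d i)) ** conj_transpose V"
    using d by (simp add: mat_abs_def mat_powr_def mat_fun_diagonalized[OF V] o_def nonneg_powr_half)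
  define v where "v = (\<lambda>j. column j V)"
  have V_cols: "V = matrix_of_columns v"
    unfolding v_def by (rule matrix_of_columns_columns)
  have v_orth: "cinner (v i) (v j) = (if i = j then 1 else 0)" for i j
    using V(1) unfolding V_cols unitary_matrix_of_columns orthonormal_on_def by simp
  have "conj_transpose X ** X ** V = V ** real_diag d"
    using V unfolding unitary_def by (metis matrix_mul_assoc matrix_mul_rid)
  then have "matrix_of_columns (\<lambda>j. (conj_transpose X ** X) *v v j) = matrix_of_columns (\<lambda>j. d j *\<^sub>R v j)"
    by (simp add: V_cols mult_matrix_of_columns matrix_of_columns_mult_real_diag)
  then have eig: "(conj_transpose X ** X) *v v j = d j *\<^sub>R v j" for j
    by (simp add: matrix_of_columns_def vec_eq_iff)
  have cX: "cinner (X *v v i) (X *v v j) = (if i = j then complex_of_real (d i) else 0)" for i j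
  proof -
    have "cinner (X *v v i) (X *v v j) = cinner (v i) ((conj_transpose X ** X) *v v j)"
      by (simp add: cinner_adjoint[of "v i" "conj_transpose X"] flip: matrix_vector_mul_assoc)
    then show ?thesis by (simp add: eig cinner_scaleR_right v_orth)
  qed
  define J where "J = {j. d j > 0}"
  define u where "u = (\<lambda>j. (1 / sqrt (d j)) *\<^sub>R (X *v v j))"
  have "orthonormal_on J u"
    unfolding orthonormal_on_def
  proof (intro ballI)
    fix i j assume "i \<in> J" "j \<in> J"
    then have "complex_of_real (1 / sqrt (d i)) * (complex_of_real (1 / sqrt (d i)) * complex_of_real (d i)) = 1"
      unfolding J_def of_real_mult[symmetric] by (simp add: field_simps)
    then show "cinner (u i) (u j) = (if i = j then 1 else 0)"
      by (auto simp: u_def cinner_scaleR_right cinner_scaleR_left cX)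
  qed
  from orthonormal_on_extend[OF this] obtain u' where
    u': "orthonormal_on UNIV u'" "\<And>j. j \<in> J \<Longrightarrow> u' j = u j" by blast
  have Xv: "X *v v j = sqrt (d j) *\<^sub>R u' j" for j
  proof (cases "j \<in> J")
    case True
    then show ?thesis by (simp add: u' u_def J_def)
  next
    case False
    then have "d j = 0" using d[of j] by (simp add: J_def)
    moreover from this have "X *v v j = 0" using cX[of j j] by (simp add: cinner_self)
    ultimately show ?thesis by simp
  qed
  define W where "W = matrix_of_columns u' ** conj_transpose V"
  have "unitary W" unfolding W_def
    using u'(1) V(1) by (intro unitary_mult unitary_conj_transpose) (simp_all add: unitary_matrix_of_columns)
  moreover have "X = W ** mat_abs X"
  proof -
    have "X ** V = matrix_of_columns u' ** real_diag (\<lambda>i. sqrt (d i))"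
      by (simp add: V_cols mult_matrix_of_columns Xv matrix_of_columns_mult_real_diag)
    also have "\<dots> = W ** mat_abs X ** V"
      using V(1) unfolding W_def abs unitary_def by (metis matrix_mul_assoc matrix_mul_rid)
    finally show ?thesis using V(1) unfolding unitary_def by (metis matrix_mul_assoc matrix_mul_rid)
  qed
  moreover have "conj_transpose (mat_abs X) = mat_abs X"
    unfolding abs by (rule conj_transpose_diagonalized)
  ultimately show ?thesis by blast
qed

section \<open>Counting and pairing of eigenvalues\<close>

lemma exists_vector_in_coordinate_subspaces:
  fixes U V B :: "complex^'n^'n"
  assumes "unitary U" "card K < card I"
  shows "\<exists>x. x \<noteq> 0 \<and> (\<forall>i. i \<notin> I \<longrightarrow> (conj_transpose U *v x) $ i = 0) \<and>
    (\<forall>k\<in>K. (conj_transpose V *v (B *v x)) $ k = 0)"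
proof -
  \<comment> \<open>\<open>C\<close> computes the coordinates of \<open>B x\<close> in the basis
    \<open>V\<close> from those of \<open>x\<close> in the basis \<open>U\<close>.\<close>
  define C where "C = conj_transpose V ** B ** U"
  from homogeneous_system_nontrivial[OF _ _ assms(2), where b = "\<lambda>k i. C $ k $ i"]
  obtain y where y: "\<exists>i\<in>I. y i \<noteq> 0" "\<forall>k\<in>K. (\<Sum>i\<in>I. C $ k $ i * y i) = 0" by auto
  define z :: "complex^'n" where "z = (\<chi> i. if i \<in> I then y i else 0)"
  have z: "z \<noteq> 0" using y(1) by (auto simp: z_def vec_eq_iff)
  have Uz: "conj_transpose U *v (U *v z) = z"
    using assms(1) by (simp add: unitary_def matrix_vector_mul_assoc)
  have "conj_transpose V *v (B *v (U *v z)) = C *v z"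
    by (simp add: C_def matrix_vector_mul_assoc matrix_mul_assoc)
  moreover have "(C *v z) $ k = 0" if "k \<in> K" for k
  proof -
    have "(C *v z) $ k = (\<Sum>i\<in>UNIV. if i \<in> I then C $ k $ i * y i else 0)"
      unfolding matrix_vector_mult_def z_def vec_lambda_beta by (intro sum.cong) auto
    also have "\<dots> = (\<Sum>i\<in>I. C $ k $ i * y i)" by (simp flip: sum.inter_filter add: sum.If_cases)
    finally show ?thesis using y(2) that by simp
  qed
  moreover have "U *v z \<noteq> 0" using Uz z by (metis matrix_vector_mult_0_right)
  ultimately show ?thesis
    by (intro exI[of _ "U *v z"]) (auto simp: Uz, simp add: z_def)
qed

text \<open>A dimension count as in the Courant-Fischer principle. If the count for \<open>S\<close>
  were larger, the span of its eigenvectors above \<open>a\<close> would contain a nonzero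
  \<open>x\<close> with \<open>B x\<close> orthogonal to all eigenvectors of \<open>H\<close> above
  \<open>b\<close>; the form of \<open>S\<close> at \<open>x\<close> would then be both above
  \<open>a |x|^2\<close> and at most that. The lemma is applied once with \<open>B = P\<close> and
  once with the identity.\<close>

lemma card_eigenvalues_gt_le:
  fixes S H :: "complex^'n^'n"
  assumes "unitary U" "S = U ** real_diag d ** conj_transpose U"
    and "unitary V" "H = V ** real_diag e ** conj_transpose V"
    and "\<And>x. (\<forall>k. b < e k \<longrightarrow> (conj_transpose V *v (B *v x)) $ k = 0) \<Longrightarrow> x \<bullet> (S *v x) \<le> a * (norm x)\<^sup>2"
  shows "card {i. a < d i} \<le> card {k. b < e k}"
proof (rule ccontr)
  assume "\<not> ?thesis"
  then have "card {k. b < e k} < card {i. a < d i}" by simp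
  from exists_vector_in_coordinate_subspaces[OF assms(1) this, of V B] obtain x where x: "x \<noteq> 0"
    "\<And>i. \<not> a < d i \<Longrightarrow> (conj_transpose U *v x) $ i = 0"
    "\<And>k. b < e k \<Longrightarrow> (conj_transpose V *v (B *v x)) $ k = 0" by auto
  have "a * (norm x)\<^sup>2 < x \<bullet> (S *v x)"
    using x(2) by (intro diagonalized_gt[OF assms(1,2) x(1)]) blast
  moreover have "x \<bullet> (S *v x) \<le> a * (norm x)\<^sup>2" using x(3) by (intro assms(5)) auto
  ultimately show False by simp
qed

text \<open>The counts allow each \<open>d i\<close> to be paired with some
  \<open>e (\<pi> i)\<close> that is at least as large. The unitary \<open>W\<close> then rotates
  the eigenvector of \<open>H\<close> for \<open>e (\<pi> i)\<close> to that of \<open>S\<close> for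
  \<open>d i\<close>.\<close>

lemma unitary_domination:
  fixes S H :: "complex^'n^'n"
  assumes "unitary U" "S = U ** real_diag d ** conj_transpose U"
    and "unitary V" "H = V ** real_diag e ** conj_transpose V" "\<And>i. 0 \<le> e i"
    and "\<And>c. 0 < c \<Longrightarrow> card {i. c < d i} \<le> card {i. c < e i}"
  shows "\<exists>W. unitary W \<and> (\<forall>x. x \<bullet> (S *v x) \<le> x \<bullet> ((W ** H ** conj_transpose W) *v x))"
proof -
  from domination_bijection[of UNIV UNIV e d] assms(5,6)
  obtain \<pi> where \<pi>: "bij \<pi>" "\<And>i. d i \<le> e (\<pi> i)" by auto
  define T where "T = matrix_of_columns (\<lambda>j. column (inv \<pi> j) U)"
  have "orthonormal_on UNIV (\<lambda>j. column j U)"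
    using assms(1) matrix_of_columns_columns[of U] unitary_matrix_of_columns by metis
  then have "orthonormal_on UNIV (\<lambda>j. column (inv \<pi> j) U)"
    using \<pi>(1) by (simp add: orthonormal_on_def inj_eq bij_imp_bij_inv bij_is_inj)
  then have T: "unitary T" by (simp add: T_def unitary_matrix_of_columns)
  have coord: "(conj_transpose T *v x) $ (\<pi> i) = (conj_transpose U *v x) $ i" for x i
    using \<pi>(1) by (simp add: T_def matrix_of_columns_def matrix_vector_mult_def column_def bij_is_inj)
  define W where "W = T ** conj_transpose V"
  have "unitary W" unfolding W_def
    using T assms(3) by (intro unitary_mult unitary_conj_transpose)
  moreover have "W ** H ** conj_transpose W = T ** real_diag e ** conj_transpose T"
    using assms(3) unfolding W_def assms(4) unitary_def conj_transpose_mult conj_transpose_conj_transpose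
    by (metis matrix_mul_assoc matrix_mul_rid)
  moreover have "x \<bullet> (S *v x) \<le> x \<bullet> ((T ** real_diag e ** conj_transpose T) *v x)" for x
  proof -
    have "x \<bullet> ((T ** real_diag e ** conj_transpose T) *v x) =
        (\<Sum>i\<in>UNIV. e i * (norm ((conj_transpose T *v x) $ i))\<^sup>2)"
      by (rule inner_diagonalized) simp
    also have "\<dots> = (\<Sum>i\<in>UNIV. e (\<pi> i) * (norm ((conj_transpose T *v x) $ \<pi> i))\<^sup>2)"
      by (rule sum.reindex_bij_betw[OF \<pi>(1), symmetric])
    also have "\<dots> \<ge> (\<Sum>i\<in>UNIV. d i * (norm ((conj_transpose U *v x) $ i))\<^sup>2)"
      unfolding coord by (intro sum_mono mult_right_mono \<pi>) simp
    finally show ?thesis by (simp add: inner_diagonalized[OF assms(2)])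
  qed
  ultimately show ?thesis by metis
qed

section \<open>Eigenvalue domination\<close>

text \<open>With \<open>w = P x\<close>, the Cauchy-Schwarz inequality for the form of
  \<open>P\<close> reads \<open>|w|^4 \<le> (x \<bullet> P x) (w \<bullet> P w)\<close>, and the
  right side is at most \<open>|x| |w| \<kappa> |w|^2\<close>. The proof uses that the form is
  nonnegative at \<open>x - t w\<close>.\<close>

lemma norm_psd_apply_le:
  fixes P :: "complex^'n^'n"
  assumes "psd P" "0 < \<kappa>" "(P *v x) \<bullet> (P *v (P *v x)) \<le> \<kappa> * (norm (P *v x))\<^sup>2"
  shows "norm (P *v x) \<le> \<kappa> * norm x"
proof -
  define w where "w = P *v x"
  \<comment> \<open>This choice turns the coefficient \<open>- 2 t + t^2 \<kappa>\<close> of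
    \<open>|w|^2\<close> into \<open>- t\<close>.\<close>
  define t where "t = 1 / \<kappa>"
  have sym: "y \<bullet> (P *v z) = (P *v y) \<bullet> z" for y z
    using assms(1) inner_matrix_vector_adjoint[of y P z] by (simp add: psd_iff)
  have "0 \<le> (x - t *\<^sub>R w) \<bullet> (P *v (x - t *\<^sub>R w))"
    using assms(1) unfolding psd_iff by blast
  also have "P *v (x - t *\<^sub>R w) = w - t *\<^sub>R (P *v w)"
    by (simp add: linear_diff linear_scale w_def)
  also have "(x - t *\<^sub>R w) \<bullet> (w - t *\<^sub>R (P *v w)) = x \<bullet> w - 2 * t * (norm w)\<^sup>2 + t\<^sup>2 * (w \<bullet> (P *v w))"
  proof -
    have "x \<bullet> (P *v w) = w \<bullet> w" by (simp add: sym flip: w_def)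
    then show ?thesis unfolding power2_norm_eq_inner
      by (simp add: inner_diff_left inner_diff_right power2_eq_square algebra_simps)
  qed
  also have "\<dots> \<le> norm x * norm w - 2 * t * (norm w)\<^sup>2 + t\<^sup>2 * (\<kappa> * (norm w)\<^sup>2)"
    using assms(2,3) norm_cauchy_schwarz[of x w] unfolding w_def
    by (intro add_mono diff_mono mult_left_mono) (auto simp: t_def)
  also have "\<dots> = norm x * norm w - t * (norm w)\<^sup>2"
    using assms(2) by (simp add: t_def power2_eq_square)
  finally have "t * norm w * norm w \<le> norm x * norm w" by (simp add: power2_eq_square)
  then have "norm w = 0 \<or> t * norm w \<le> norm x" by (auto simp: mult_le_cancel_right)
  then show ?thesis using assms(2) by (auto simp: t_def w_def field_simps)
qed

text \<open>The hypotheses \<open>upper\<close> and \<open>lower\<close> are the tangent-line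
  estimates at \<open>c\<close> for \<open>y^\<alpha>\<close> and \<open>y^m\<close> in terms of
  quadratic forms. With \<open>c^m = t\<close> they yield a chain: \<open>P Q^s P\<close> has at
  most as many eigenvalues above \<open>t\<close> as \<open>Q\<close> has above \<open>c\<close>,
  and \<open>Q\<close> at most as many as \<open>H\<close> has above \<open>t\<close>. The lemma
  serves for \<open>P\<close> and, with \<beta> and \<open>2 - s\<close>, for
  \<open>R\<close>.\<close>

lemma sandwich_domination:
  fixes P Q H :: "complex^'n^'n"
  assumes psd: "psd P" "psd H"
    and Q: "unitary W" "Q = W ** real_diag d ** conj_transpose W" "\<And>i. 0 \<le> d i"
    and exps: "0 \<le> \<alpha>" "\<alpha> \<le> 1" "0 \<le> s" "s + 2 * \<alpha> = m" "1 \<le> m"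
    and upper: "\<And>c h. 0 < c \<Longrightarrow>
      h \<bullet> (P *v h) \<le> c powr \<alpha> * (\<alpha> * (h \<bullet> (Q *v h)) / c + (1 - \<alpha>) * (norm h)\<^sup>2)"
    and lower: "\<And>c h. 0 < c \<Longrightarrow>
      c powr m * (m * (h \<bullet> (Q *v h)) / c - (m - 1) * (norm h)\<^sup>2) \<le> h \<bullet> (H *v h)"
  shows "\<exists>U. unitary U \<and> (\<forall>x. x \<bullet> ((P ** (W ** real_diag (nonneg_powr s \<circ> d) ** conj_transpose W) ** P) *v x)
    \<le> x \<bullet> ((U ** H ** conj_transpose U) *v x))"
proof -
  define Qs where "Qs = W ** real_diag (nonneg_powr s \<circ> d) ** conj_transpose W"
  define S where "S = P ** Qs ** P"
  have P_herm: "conj_transpose P = P" using psd(1) by (simp add: psd_iff)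
  have "conj_transpose Qs = Qs" unfolding Qs_def by (rule conj_transpose_diagonalized)
  then have "conj_transpose S = S" by (simp add: S_def conj_transpose_mult P_herm matrix_mul_assoc)
  then obtain U e where U: "unitary U" "S = U ** real_diag e ** conj_transpose U"
    using spectral_theorem by blast
  obtain V f where V: "unitary V" "H = V ** real_diag f ** conj_transpose V" "\<And>i. 0 \<le> f i"
    using psd_diagonalization[OF psd(2)] by blast
  have "card {i. t < e i} \<le> card {i. t < f i}" if t: "0 < t" for t
  proof -
    define c where "c = t powr (1 / m)"
    have c: "0 < c" "c powr m = t" using t exps by (simp_all add: c_def powr_powr)
    have "card {i. t < e i} \<le> card {i. c < d i}"
    proof (rule card_eigenvalues_gt_le[OF U Q(1,2), of c P t])
      fix x assume x: "\<forall>k. c < d k \<longrightarrow> (conj_transpose W *v (P *v x)) $ k = 0"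
      define w where "w = P *v x"
      have dc: "d k \<le> c" if "(conj_transpose W *v w) $ k \<noteq> 0" for k
        using x that by (force simp: w_def)
      have "w \<bullet> (Q *v w) \<le> c * (norm w)\<^sup>2" using dc by (rule diagonalized_le[OF Q(1,2)])
      then have "c powr \<alpha> * (\<alpha> * (w \<bullet> (Q *v w)) / c + (1 - \<alpha>) * (norm w)\<^sup>2)
          \<le> c powr \<alpha> * (\<alpha> * (norm w)\<^sup>2 + (1 - \<alpha>) * (norm w)\<^sup>2)"
        using c exps by (intro mult_left_mono add_right_mono) (simp_all add: field_simps mult_left_mono)
      also have "\<dots> = c powr \<alpha> * (norm w)\<^sup>2" by (simp add: algebra_simps)
      finally have "w \<bullet> (P *v w) \<le> c powr \<alpha> * (norm w)\<^sup>2"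
        using upper[OF c(1), of w] by linarith
      then have "norm w \<le> c powr \<alpha> * norm x"
        using norm_psd_apply_le[OF psd(1)] c(1) by (simp add: w_def)
      then have nw: "(norm w)\<^sup>2 \<le> (c powr \<alpha>)\<^sup>2 * (norm x)\<^sup>2"
        by (metis norm_ge_zero power_mono power_mult_distrib)
      \<comment> \<open>Each of the two factors \<open>P\<close> contributes
        \<open>c^\<alpha>\<close> and the power of \<open>Q\<close> contributes \<open>c^s\<close>,
        in total \<open>c^m = t\<close>.\<close>
      have "x \<bullet> (S *v x) = w \<bullet> (Qs *v w)"
        by (simp add: S_def w_def inner_matrix_vector_adjoint[of x P] P_herm flip: matrix_vector_mul_assoc)
      also have "\<dots> \<le> c powr s * (norm w)\<^sup>2"
      proof (rule diagonalized_le[OF Q(1) Qs_def])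
        fix k assume "(conj_transpose W *v w) $ k \<noteq> 0"
        from dc[OF this] show "(nonneg_powr s \<circ> d) k \<le> c powr s"
          using Q(3)[of k] exps c by (auto simp: nonneg_powr_def intro: powr_mono2)
      qed
      also have "\<dots> \<le> c powr s * ((c powr \<alpha>)\<^sup>2 * (norm x)\<^sup>2)" using nw by (intro mult_left_mono) auto
      also have "c powr s * ((c powr \<alpha>)\<^sup>2 * (norm x)\<^sup>2) = c powr (s + 2 * \<alpha>) * (norm x)\<^sup>2"
        by (simp only: powr_add power2_eq_square mult_2 mult.assoc)
      also have "\<dots> = t * (norm x)\<^sup>2" by (simp add: exps c)
      finally show "x \<bullet> (S *v x) \<le> t * (norm x)\<^sup>2" .
    qed
    also have "\<dots> \<le> card {i. t < f i}"
    proof (rule card_eigenvalues_gt_le[OF Q(1,2) V(1,2), of t "mat 1" c])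
      fix x assume x: "\<forall>k. t < f k \<longrightarrow> (conj_transpose V *v (mat 1 *v x)) $ k = 0"
      have "x \<bullet> (H *v x) \<le> t * (norm x)\<^sup>2"
        using x by (intro diagonalized_le[OF V(1,2)]) (force simp: not_less)
      \<comment> \<open>The estimate \<open>lower\<close> converts the bound on the form of
        \<open>H\<close> into one on the form of \<open>Q\<close>; the common factor
        \<open>c^m = t\<close> cancels.\<close>
      with lower[OF c(1), of x] have "t * (m * (x \<bullet> (Q *v x)) / c - (m - 1) * (norm x)\<^sup>2) \<le> t * (norm x)\<^sup>2"
        unfolding c(2) by linarith
      then have "m * (x \<bullet> (Q *v x)) / c - (m - 1) * (norm x)\<^sup>2 \<le> (norm x)\<^sup>2"
        using t by (simp only: mult_le_cancel_left_pos)
      then have "m * (x \<bullet> (Q *v x)) / c \<le> m * (norm x)\<^sup>2" by (simp add: algebra_simps)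
      then show "x \<bullet> (Q *v x) \<le> c * (norm x)\<^sup>2"
        using c(1) exps by (simp add: field_simps)
    qed
    finally show ?thesis .
  qed
  from unitary_domination[OF U V this] show ?thesis unfolding S_def Qs_def .
qed

section \<open>Splitting the modulus of the triple product\<close>

lemma mat_abs_gram_le:
  fixes X Y\<^sub>1 Y\<^sub>2 :: "complex^'n^'n"
  assumes "X = conj_transpose Y\<^sub>1 ** Y\<^sub>2"
  shows "\<exists>W. unitary W \<and> conj_transpose (mat_abs X) = mat_abs X \<and>
    (\<forall>x. 2 * (x \<bullet> (mat_abs X *v x)) \<le>
      (W *v x) \<bullet> ((conj_transpose Y\<^sub>1 ** Y\<^sub>1) *v (W *v x)) + x \<bullet> ((conj_transpose Y\<^sub>2 ** Y\<^sub>2) *v x))"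
proof -
  obtain W where W: "unitary W" "conj_transpose (mat_abs X) = mat_abs X" "X = W ** mat_abs X"
    using polar_decomposition by blast
  have "2 * (x \<bullet> (mat_abs X *v x)) \<le>
      (W *v x) \<bullet> ((conj_transpose Y\<^sub>1 ** Y\<^sub>1) *v (W *v x)) + x \<bullet> ((conj_transpose Y\<^sub>2 ** Y\<^sub>2) *v x)" for x
  proof -
    have gram: "y \<bullet> ((conj_transpose Y ** Z) *v z) = (Y *v y) \<bullet> (Z *v z)" for y z and Y Z :: "complex^'n^'n"
      by (simp add: inner_matrix_vector_adjoint[of y "conj_transpose Y"] flip: matrix_vector_mul_assoc)
    have "mat_abs X = conj_transpose W ** X"
      using W unfolding unitary_def by (metis matrix_mul_assoc matrix_mul_lid)
    then have "x \<bullet> (mat_abs X *v x) = (Y\<^sub>1 *v (W *v x)) \<bullet> (Y\<^sub>2 *v x)"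
      by (simp add: gram) (simp add: assms gram)
    \<comment> \<open>This is \<open>2 a \<bullet> b \<le> |a|^2 + |b|^2\<close> for the two vectors
      whose inner product is the form of the modulus.\<close>
    moreover have "0 \<le> (Y\<^sub>1 *v (W *v x) - Y\<^sub>2 *v x) \<bullet> (Y\<^sub>1 *v (W *v x) - Y\<^sub>2 *v x)" by simp
    ultimately show ?thesis by (simp add: gram inner_diff_left inner_diff_right inner_commute)
  qed
  with W show ?thesis by blast
qed

lemma scaleR_matrix_vector_mult: "(c *\<^sub>R M) *v x = c *\<^sub>R (M *v x)" for M :: "complex^'n^'m"
  by (simp add: vec_eq_iff matrix_vector_mult_def scaleR_sum_right)

lemma real_diag_mult: "real_diag d ** real_diag e = real_diag (\<lambda>i. d i * e i)"
proof -
  have "(real_diag d ** real_diag e) $ i $ j = real_diag (\<lambda>i. d i * e i) $ i $ j" for i j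
  proof -
    have "(real_diag d ** real_diag e) $ i $ j =
        (\<Sum>k\<in>UNIV. if k = i then complex_of_real (d i) * real_diag e $ i $ j else 0)"
      unfolding matrix_matrix_mult_def vec_lambda_beta by (intro sum.cong) (auto simp: real_diag_def)
    then show ?thesis by (simp add: real_diag_def)
  qed
  then show ?thesis by (simp add: vec_eq_iff)
qed

lemma diagonalized_mult:
  assumes "unitary W"
  shows "(W ** real_diag d ** conj_transpose W) ** (W ** real_diag e ** conj_transpose W) =
    W ** real_diag (\<lambda>i. d i * e i) ** conj_transpose W"
proof -
  have "(W ** real_diag d ** conj_transpose W) ** (W ** real_diag e ** conj_transpose W) =
      W ** real_diag d ** (conj_transpose W ** W) ** real_diag e ** conj_transpose W"
    by (simp only: matrix_mul_assoc)
  also have "\<dots> = W ** (real_diag d ** real_diag e) ** conj_transpose W"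
    using assms by (simp add: unitary_def matrix_mul_assoc)
  finally show ?thesis by (simp only: real_diag_mult)
qed

lemma nonneg_powr_add:
  assumes "0 \<le> x" "0 \<le> a" "0 \<le> b"
  shows "nonneg_powr (a + b) x = nonneg_powr a x * nonneg_powr b x"
  using assms by (auto simp: nonneg_powr_def powr_add)

lemma nonneg_powr_one: "0 \<le> x \<Longrightarrow> nonneg_powr 1 x = x"
  by (simp add: nonneg_powr_def)

text \<open>The matrix core of the theorem: of the positive map only positive semidefinite images
  and three tangent-line estimates are retained.\<close>

lemma mat_abs_triple_product_le:
  fixes P Q R H :: "complex^'n^'n"
  assumes psd: "psd P" "psd Q" "psd R" "psd H"
    and \<alpha>: "0 \<le> \<alpha>" "\<alpha> \<le> 1" and \<beta>: "0 \<le> \<beta>" "\<beta> \<le> 1"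
    and P_le: "\<And>c h. 0 < c \<Longrightarrow>
      h \<bullet> (P *v h) \<le> c powr \<alpha> * (\<alpha> * (h \<bullet> (Q *v h)) / c + (1 - \<alpha>) * (norm h)\<^sup>2)"
    and R_le: "\<And>c h. 0 < c \<Longrightarrow>
      h \<bullet> (R *v h) \<le> c powr \<beta> * (\<beta> * (h \<bullet> (Q *v h)) / c + (1 - \<beta>) * (norm h)\<^sup>2)"
    and H_ge: "\<And>c h. 0 < c \<Longrightarrow>
      c powr (1 + \<alpha> + \<beta>) * ((1 + \<alpha> + \<beta>) * (h \<bullet> (Q *v h)) / c - (1 + \<alpha> + \<beta> - 1) * (norm h)\<^sup>2)
        \<le> h \<bullet> (H *v h)"
  shows "\<exists>U V. unitary U \<and> unitary V \<and>
    mat_abs (P ** Q ** R) \<preceq> (1/2) *\<^sub>R (U ** H ** conj_transpose U + V ** H ** conj_transpose V)"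
proof -
  have herm: "conj_transpose P = P" "conj_transpose R = R" "conj_transpose H = H"
    using psd by (simp_all add: psd_iff)
  obtain D d where Q: "unitary D" "Q = D ** real_diag d ** conj_transpose D" "\<And>i. 0 \<le> d i"
    using psd_diagonalization[OF psd(2)] by blast
  define pow where "pow = (\<lambda>s. D ** real_diag (nonneg_powr s \<circ> d) ** conj_transpose D)"
  have pow_herm: "conj_transpose (pow s) = pow s" for s
    unfolding pow_def by (rule conj_transpose_diagonalized)
  have pow_add: "pow a ** pow b = pow (a + b)" if "0 \<le> a" "0 \<le> b" for a b
    using Q(3) that by (simp add: pow_def diagonalized_mult[OF Q(1)] nonneg_powr_add o_def)
  have pow_one: "pow 1 = Q" using Q(3) by (simp add: pow_def Q(2) nonneg_powr_one o_def)
  \<comment> \<open>This \<open>s\<close> solves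
    \<open>s + 2 \<alpha> = (2 - s) + 2 \<beta>\<close>, so that \<open>P Q^s P\<close> and
    \<open>R Q^(2-s) R\<close> both have total exponent \<open>1 + \<alpha> + \<beta>\<close>, that
    of \<open>H\<close>.\<close>
  define s where "s = 1 + \<beta> - \<alpha>"
  have s: "0 \<le> s" "0 \<le> 2 - s" using \<alpha> \<beta> by (simp_all add: s_def)
  define Y\<^sub>1 where "Y\<^sub>1 = pow (s / 2) ** P"
  define Y\<^sub>2 where "Y\<^sub>2 = pow (1 - s / 2) ** R"
  have Y1: "conj_transpose Y\<^sub>1 ** Y\<^sub>1 = P ** pow s ** P"
    using pow_add[of "s / 2" "s / 2"] s unfolding Y\<^sub>1_def conj_transpose_mult pow_herm herm
    by (metis add_divide_distrib divide_nonneg_pos field_sum_of_halves matrix_mul_assoc zero_less_numeral)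
  have Y2: "conj_transpose Y\<^sub>2 ** Y\<^sub>2 = R ** pow (2 - s) ** R"
  proof -
    have "pow (1 - s / 2) ** pow (1 - s / 2) = pow (2 - s)"
      using pow_add[of "1 - s / 2" "1 - s / 2"] s by simp
    then show ?thesis unfolding Y\<^sub>2_def conj_transpose_mult pow_herm herm by (metis matrix_mul_assoc)
  qed
  have "P ** Q ** R = conj_transpose Y\<^sub>1 ** Y\<^sub>2"
  proof -
    have "pow (s / 2) ** pow (1 - s / 2) = Q"
      using pow_add[of "s / 2" "1 - s / 2"] s pow_one by simp
    then show ?thesis unfolding Y\<^sub>1_def Y\<^sub>2_def conj_transpose_mult pow_herm herm by (metis matrix_mul_assoc)
  qed
  from mat_abs_gram_le[OF this] obtain W where W: "unitary W"
    "conj_transpose (mat_abs (P ** Q ** R)) = mat_abs (P ** Q ** R)"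
    "\<And>x. 2 * (x \<bullet> (mat_abs (P ** Q ** R) *v x)) \<le>
      (W *v x) \<bullet> ((P ** pow s ** P) *v (W *v x)) + x \<bullet> ((R ** pow (2 - s) ** R) *v x)"
    unfolding Y1 Y2 by blast
  obtain U where U: "unitary U"
    "\<And>x. x \<bullet> ((P ** pow s ** P) *v x) \<le> x \<bullet> ((U ** H ** conj_transpose U) *v x)"
    using sandwich_domination[OF psd(1,4) Q \<alpha> s(1) _ _ P_le H_ge] \<alpha> \<beta> unfolding pow_def s_def by auto
  obtain V where V: "unitary V"
    "\<And>x. x \<bullet> ((R ** pow (2 - s) ** R) *v x) \<le> x \<bullet> ((V ** H ** conj_transpose V) *v x)"
    using sandwich_domination[OF psd(3,4) Q \<beta> s(2) _ _ R_le H_ge] \<alpha> \<beta> unfolding pow_def s_def by auto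
  \<comment> \<open>The unitary of the polar decomposition is absorbed into the first conjugating
    unitary.\<close>
  define U' where "U' = conj_transpose W ** U"
  have U': "unitary U'" unfolding U'_def using W(1) U(1) by (intro unitary_mult unitary_conj_transpose)
  have U'_eq: "(W *v x) \<bullet> ((U ** H ** conj_transpose U) *v (W *v x)) = x \<bullet> ((U' ** H ** conj_transpose U') *v x)" for x
    unfolding inner_congruence
    by (simp add: U'_def conj_transpose_mult flip: matrix_vector_mul_assoc)
  have two_le: "2 * (x \<bullet> (mat_abs (P ** Q ** R) *v x)) \<le>
      x \<bullet> ((U' ** H ** conj_transpose U') *v x) + x \<bullet> ((V ** H ** conj_transpose V) *v x)" for x
    using W(3)[of x] U(2)[of "W *v x"] V(2)[of x] U'_eq[of x] by linarith
  have "x \<bullet> (mat_abs (P ** Q ** R) *v x) \<le>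
      x \<bullet> (((1/2) *\<^sub>R (U' ** H ** conj_transpose U' + V ** H ** conj_transpose V)) *v x)" for x
    unfolding scaleR_matrix_vector_mult matrix_vector_mult_add_rdistrib inner_scaleR_right inner_add_right
    using two_le[of x] by (simp add: field_simps)
  moreover have "conj_transpose ((1/2) *\<^sub>R (U' ** H ** conj_transpose U' + V ** H ** conj_transpose V)) =
      (1/2) *\<^sub>R (U' ** H ** conj_transpose U' + V ** H ** conj_transpose V)"
    by (simp add: conj_transpose_scaleR conj_transpose_add conj_transpose_mult herm matrix_mul_assoc)
  ultimately show ?thesis using U' V(1) W(2) loewner_le_iff by blast
qed

section \<open>Invertible elements and the spectral radius\<close>

lemma scaleC_one: "1 *\<^sub>C x = x" for x :: "'a::cstar_algebra"
  using scaleC_of_real[of 1 x] by simp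

lemma scaleC_zero_left: "0 *\<^sub>C x = 0" for x :: "'a::cstar_algebra"
  using scaleC_of_real[of 0 x] by simp

lemma scaleC_zero_right: "c *\<^sub>C (0 :: 'a::cstar_algebra) = 0"
  using scaleC_add_right[of c "0 :: 'a" 0] by simp

lemma scaleC_minus_left: "(- c) *\<^sub>C x = - (c *\<^sub>C x)" for x :: "'a::cstar_algebra"
  using scaleC_add_left[of "- c" c x] by (simp add: scaleC_zero_left eq_neg_iff_add_eq_0)

lemma scaleC_minus_right: "c *\<^sub>C (- x) = - (c *\<^sub>C x)" for x :: "'a::cstar_algebra"
  using scaleC_add_right[of c "- x" x] by (simp add: scaleC_zero_right eq_neg_iff_add_eq_0)

lemma scaleC_diff_right: "c *\<^sub>C (x - y) = c *\<^sub>C x - c *\<^sub>C y" for x y :: "'a::cstar_algebra"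
  using scaleC_add_right[of c x "- y"] by (simp add: scaleC_minus_right)

lemma scaleC_sum_left: "(\<Sum>i\<in>I. f i) *\<^sub>C x = (\<Sum>i\<in>I. f i *\<^sub>C x)" for x :: "'a::cstar_algebra"
  by (induction I rule: infinite_finite_induct) (simp_all add: scaleC_zero_left scaleC_add_left)

lemma scaleC_power: "(c *\<^sub>C x) ^ n = (c ^ n) *\<^sub>C (x ^ n)" for x :: "'a::cstar_algebra"
  by (induction n) (simp_all add: scaleC_one scaleC_mult_left scaleC_mult_right scaleC_scaleC mult.commute)

lemma bounded_bilinear_scaleC: "bounded_bilinear (scaleC :: complex \<Rightarrow> 'a \<Rightarrow> 'a::cstar_algebra)"
proof
  show "\<exists>K. \<forall>c (x :: 'a). norm (c *\<^sub>C x) \<le> norm c * norm x * K"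
    by (intro exI[of _ 1]) (simp add: norm_scaleC)
qed (simp_all add: scaleC_add_left scaleC_add_right scaleR_conv_of_real scaleC_scaleC mult.commute
    flip: scaleC_of_real)

lemma star_zero: "star (0 :: 'a::cstar_algebra) = 0"
  using star_add[of "0 :: 'a" 0] by simp

lemma star_one: "star (1 :: 'a::cstar_algebra) = 1"
  using star_mult[of "star 1" "1 :: 'a"] by (simp add: star_star)

lemma star_sum: "star (\<Sum>i\<in>I. f i) = (\<Sum>i\<in>I. star (f i))" for f :: "'i \<Rightarrow> 'a::cstar_algebra"
  by (induction I rule: infinite_finite_induct) (simp_all add: star_zero star_add)

lemma star_power: "star (x ^ n) = star x ^ n" for x :: "'a::cstar_algebra"
  by (induction n) (simp_all add: star_one star_mult power_commutes)

lemma norm_star: "norm (star x) = norm x" for x :: "'a::cstar_algebra"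
proof -
  have *: "norm y \<le> norm (star y)" for y :: 'a
  proof -
    have "norm y * norm y \<le> norm (star y) * norm y"
      using norm_star_mult_self[of y] norm_mult_ineq[of "star y" y] by (simp add: power2_eq_square)
    then show ?thesis by (cases "y = 0") simp_all
  qed
  from *[of x] *[of "star x"] show ?thesis by (simp add: star_star)
qed

lemma bounded_linear_star: "bounded_linear (star :: 'a \<Rightarrow> 'a::cstar_algebra)"
proof
  show "star (r *\<^sub>R x) = r *\<^sub>R star x" for r and x :: 'a
    using star_scaleC[of "complex_of_real r" x] by (simp add: scaleC_of_real)
  show "\<exists>K. \<forall>x :: 'a. norm (star x) \<le> norm x * K"
    by (intro exI[of _ 1]) (simp add: norm_star)
qed (rule star_add)

text \<open>By the C*-identity the norm of the unit is idempotent, hence 0 or 1; the value 0 occurs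
  in the zero algebra.\<close>

lemma norm_one_le: "norm (1 :: 'a::cstar_algebra) \<le> 1"
  using norm_star_mult_self[of "1 :: 'a"] by (auto simp: star_one power2_eq_square)

lemma norm_power_le: "norm (x ^ n) \<le> norm x ^ n" for x :: "'a::cstar_algebra"
proof (induction n)
  case 0
  then show ?case by (simp add: norm_one_le)
next
  case (Suc n)
  have "norm (x ^ Suc n) \<le> norm x * norm (x ^ n)" by (simp add: norm_mult_ineq)
  also have "\<dots> \<le> norm x * norm x ^ n" using Suc by (intro mult_left_mono) auto
  finally show ?case by simp
qed

lemma one_minus_mult_sum_power: "(1 - x) * (\<Sum>i<n. x ^ i) = 1 - x ^ n" for x :: "'a::cstar_algebra"
  by (induction n) (simp_all add: distrib_left left_diff_distrib)

lemma sum_power_mult_one_minus: "(\<Sum>i<n. x ^ i) * (1 - x) = 1 - x ^ n" for x :: "'a::cstar_algebra"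
proof (induction n)
  case (Suc n)
  have "(\<Sum>i<Suc n. x ^ i) * (1 - x) = (\<Sum>i<n. x ^ i) * (1 - x) + x ^ n * (1 - x)"
    by (simp only: sum.lessThan_Suc distrib_right)
  then show ?case unfolding Suc by (simp add: right_diff_distrib power_commutes)
qed simp

section \<open>Invertible elements and compactness of the spectrum\<close>

definition has_inverse :: "'a::cstar_algebra \<Rightarrow> bool" where
  "has_inverse a \<longleftrightarrow> (\<exists>b. b * a = 1 \<and> a * b = 1)"

definition inverse_of :: "'a::cstar_algebra \<Rightarrow> 'a" where
  "inverse_of a = (SOME b. b * a = 1 \<and> a * b = 1)"

lemma spectrum_iff: "z \<in> spectrum a \<longleftrightarrow> \<not> has_inverse (a - z *\<^sub>C 1)"
  by (simp add: spectrum_def has_inverse_def)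

lemma has_inverseI: "b * a = 1 \<Longrightarrow> a * b = 1 \<Longrightarrow> has_inverse a"
  by (auto simp: has_inverse_def)

lemma inverse_of:
  assumes "has_inverse a"
  shows "inverse_of a * a = 1" "a * inverse_of a = 1"
  using someI_ex[OF assms[unfolded has_inverse_def]] unfolding inverse_of_def by auto

lemma has_inverse_mult: "has_inverse a \<Longrightarrow> has_inverse b \<Longrightarrow> has_inverse (a * b)"
  by (rule has_inverseI[of "inverse_of b * inverse_of a"])
    (metis inverse_of mult.assoc mult.right_neutral)+

lemma has_inverse_scaleC: "c \<noteq> 0 \<Longrightarrow> has_inverse a \<Longrightarrow> has_inverse (c *\<^sub>C a)"
  by (rule has_inverseI[of "(1 / c) *\<^sub>C inverse_of a"])
    (simp_all add: scaleC_mult_left scaleC_mult_right scaleC_scaleC inverse_of scaleC_one)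

lemma has_inverse_one: "has_inverse 1"
  by (rule has_inverseI[of 1]) simp_all

text \<open>Neumann series: the partial sums multiply with \<open>1 - x\<close> to
  \<open>1 - x ^ n\<close> on either side, and this tends to 1.\<close>

lemma has_inverse_one_minus:
  fixes x :: "'a::cstar_algebra"
  assumes "norm x < 1"
  shows "has_inverse (1 - x)"
proof -
  have s: "summable (\<lambda>n. x ^ n)"
  proof (rule summable_comparison_test')
    show "summable (\<lambda>n. norm x ^ n)" using assms by (intro summable_geometric) simp
  qed (rule norm_power_le)
  then have lim: "(\<lambda>n. \<Sum>i<n. x ^ i) \<longlonglongrightarrow> (\<Sum>i. x ^ i)" by (rule summable_LIMSEQ)
  have pow: "(\<lambda>n. 1 - x ^ n) \<longlonglongrightarrow> 1"
    using tendsto_diff[OF tendsto_const summable_LIMSEQ_zero[OF s], of 1] by simp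
  have "(\<lambda>n. 1 - x ^ n) \<longlonglongrightarrow> (1 - x) * (\<Sum>i. x ^ i)" "(\<lambda>n. 1 - x ^ n) \<longlonglongrightarrow> (\<Sum>i. x ^ i) * (1 - x)"
    using tendsto_mult_left[OF lim, of "1 - x"] tendsto_mult_right[OF lim, of "1 - x"]
    by (simp_all add: one_minus_mult_sum_power sum_power_mult_one_minus)
  from this[THEN LIMSEQ_unique[OF pow]] show ?thesis
    by (intro has_inverseI[of "\<Sum>i. x ^ i"]) simp_all
qed

text \<open>Writing \<open>b = a (1 - a^-1 (a - b))\<close> reduces this to the Neumann
  series.\<close>

lemma has_inverse_near:
  fixes a b :: "'a::cstar_algebra"
  assumes "has_inverse a" "norm (inverse_of a) * norm (b - a) < 1"
  shows "has_inverse b"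
proof -
  have "norm (inverse_of a * (a - b)) < 1"
    using norm_mult_ineq[of "inverse_of a" "a - b"] assms(2) by (simp add: norm_minus_commute)
  then have "has_inverse (a * (1 - inverse_of a * (a - b)))"
    by (intro has_inverse_mult assms has_inverse_one_minus)
  also have "a * (1 - inverse_of a * (a - b)) = b"
    by (simp add: right_diff_distrib inverse_of[OF assms(1)] flip: mult.assoc)
  finally show ?thesis .
qed

lemma open_has_inverse: "open {a :: 'a::cstar_algebra. has_inverse a}"
  unfolding open_dist
proof safe
  fix a :: 'a assume a: "has_inverse a"
  let ?e = "1 / (norm (inverse_of a) + 1)"
  have "has_inverse b" if "dist b a < ?e" for b
  proof (rule has_inverse_near[OF a])
    have "norm (inverse_of a) * norm (b - a) \<le> norm (inverse_of a) * ?e"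
      using that by (intro mult_left_mono) (simp_all add: dist_norm)
    also have "\<dots> < 1" by (simp add: divide_less_eq add_nonneg_pos)
    finally show "norm (inverse_of a) * norm (b - a) < 1" .
  qed
  then show "\<exists>e>0. \<forall>b. dist b a < e \<longrightarrow> b \<in> {a. has_inverse a}"
    by (intro exI[of _ ?e]) (auto simp: add_nonneg_pos)
qed

lemma continuous_on_inverse_of: "continuous_on {a :: 'a::cstar_algebra. has_inverse a} inverse_of"
  unfolding continuous_on_iff
proof safe
  fix a :: 'a and e :: real
  assume a: "has_inverse a" and e: "0 < e"
  define N where "N = norm (inverse_of a)"
  have N: "0 \<le> N" by (simp add: N_def)
  \<comment> \<open>The first bound ensures \<open>|b^-1| \<le> 2 N\<close>. The second makes the
    difference \<open>b^-1 - a^-1 = b^-1 (a - b) a^-1\<close> smaller than \<open>e\<close>. The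
    summands 1 keep the denominators positive if \<open>N = 0\<close>.\<close>
  define \<delta> where "\<delta> = min (1 / (2 * (N + 1))) (e / (2 * N * N + 1))"
  have "0 < \<delta>" using N e by (simp add: \<delta>_def add_nonneg_pos)
  moreover have "dist (inverse_of b) (inverse_of a) < e" if b: "has_inverse b" "dist b a < \<delta>" for b
  proof -
    define D where "D = norm (b - a)"
    have D: "0 \<le> D" "D < 1 / (2 * (N + 1))" "D < e / (2 * N * N + 1)"
      using b(2) by (simp_all add: D_def \<delta>_def dist_norm)
    have eq: "inverse_of b - inverse_of a = inverse_of b * (a - b) * inverse_of a"
      by (simp add: right_diff_distrib left_diff_distrib inverse_of[OF b(1)])
        (simp add: mult.assoc inverse_of[OF a])
    have le: "norm (inverse_of b - inverse_of a) \<le> norm (inverse_of b) * D * N"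
    proof -
      have "norm (inverse_of b - inverse_of a) \<le> norm (inverse_of b * (a - b)) * N"
        unfolding eq N_def by (rule norm_mult_ineq)
      also have "\<dots> \<le> norm (inverse_of b) * D * N"
        using norm_mult_ineq[of "inverse_of b" "a - b"]
        by (intro mult_right_mono) (simp_all add: D_def N_def norm_minus_commute)
      finally show ?thesis .
    qed
    have DN: "D * N \<le> 1 / 2"
    proof -
      have "D * N \<le> D * (N + 1)" using D by (intro mult_left_mono) auto
      also have "\<dots> \<le> 1 / (2 * (N + 1)) * (N + 1)" using D N by (intro mult_right_mono) auto
      also have "\<dots> = 1 / 2" using N by (simp add: field_simps)
      finally show ?thesis .
    qed
    have "norm (inverse_of b) \<le> N + norm (inverse_of b - inverse_of a)"
      using norm_triangle_ineq[of "inverse_of a" "inverse_of b - inverse_of a"] by (simp add: N_def)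
    also have "\<dots> \<le> N + norm (inverse_of b) * (D * N)" using le by (simp add: mult.assoc)
    also have "\<dots> \<le> N + norm (inverse_of b) * (1 / 2)" using DN by (intro add_left_mono mult_left_mono) auto
    finally have "norm (inverse_of b) \<le> 2 * N" by simp
    then have "norm (inverse_of b) * D * N \<le> 2 * N * D * N"
      using D N by (intro mult_right_mono) auto
    with le have "norm (inverse_of b - inverse_of a) \<le> (2 * N * N) * D" by (simp add: algebra_simps)
    also have "\<dots> \<le> (2 * N * N + 1) * D" using D by (intro mult_right_mono) auto
    also have "\<dots> < e" using D(3) N by (simp add: pos_less_divide_eq add_nonneg_pos mult.commute)
    finally show ?thesis by (simp add: dist_norm)
  qed
  ultimately show "\<exists>d>0. \<forall>b\<in>{a. has_inverse a}. dist b a < d \<longrightarrow> dist (inverse_of b) (inverse_of a) < e"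
    by blast
qed

text \<open>The complement is a preimage of the open set of invertible elements, and
  \<open>a - z = - z (1 - a / z)\<close> is invertible for \<open>|z| > |a|\<close>.\<close>

lemma compact_spectrum: "compact (spectrum a)"
proof -
  have "closed (spectrum a)"
  proof -
    have "spectrum a = - ((\<lambda>z. a - z *\<^sub>C 1) -` {a. has_inverse a})"
      by (auto simp: spectrum_iff)
    moreover have "open ((\<lambda>z. a - z *\<^sub>C 1) -` {a. has_inverse a})"
      by (intro open_vimage open_has_inverse continuous_intros
          bounded_bilinear.continuous_on[OF bounded_bilinear_scaleC])
    ultimately show ?thesis by (simp only: closed_Compl)
  qed
  moreover have "norm z \<le> norm a" if "z \<in> spectrum a" for z
  proof (rule ccontr)
    assume "\<not> norm z \<le> norm a"
    then have z: "norm a < norm z" by simp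
    then have "z \<noteq> 0" by auto
    have "norm ((1 / z) *\<^sub>C a) < 1" using z by (simp add: norm_scaleC norm_divide divide_less_eq)
    then have "has_inverse ((- z) *\<^sub>C (1 - (1 / z) *\<^sub>C a))"
      using \<open>z \<noteq> 0\<close> by (intro has_inverse_scaleC has_inverse_one_minus) auto
    also have "(- z) *\<^sub>C (1 - (1 / z) *\<^sub>C a) = a - z *\<^sub>C 1"
      using \<open>z \<noteq> 0\<close> by (simp add: scaleC_diff_right scaleC_scaleC scaleC_minus_left scaleC_one)
    finally show False using that by (simp add: spectrum_iff)
  qed
  then have "bounded (spectrum a)" by (auto simp: bounded_iff)
  ultimately show ?thesis by (simp add: compact_eq_bounded_closed)
qed

section \<open>Roots of unity and the spectral radius\<close>

lemma cis_root_of_unity: "0 < n \<Longrightarrow> cis (2 * pi / real n) ^ n = 1"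
  by (subst Complex.DeMoivre) simp

lemma sum_roots_of_unity_power:
  assumes "0 < n" "j < n"
  shows "(\<Sum>k<n. (cis (2 * pi / n) ^ k) ^ j) = (if j = 0 then of_nat n else 0)"
proof (cases "j = 0")
  case False
  define \<omega> where "\<omega> = cis (2 * pi / n)"
  have \<omega>: "\<omega> ^ n = 1" using assms by (simp add: \<omega>_def cis_root_of_unity)
  \<comment> \<open>Otherwise \<open>n\<close> would divide \<open>j\<close>, although
    \<open>0 < j < n\<close>. So the geometric sum with ratio \<open>\<omega> ^ j\<close>
    vanishes.\<close>
  have "\<omega> ^ j \<noteq> 1"
  proof
    assume "\<omega> ^ j = 1"
    then have "cos (j * (2 * pi / n)) = 1"
      by (simp add: \<omega>_def Complex.DeMoivre complex_eq_iff)
    then obtain m :: int where "j * (2 * pi / n) = of_int m * 2 * pi"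
      unfolding cos_one_2pi_int by blast
    then have "real j = of_int m * real n" using assms by (simp add: field_simps)
    then have m: "int j = m * int n" by (metis of_int_eq_iff of_int_mult of_int_of_nat_eq)
    then have "int n dvd int j" by simp
    then show False using assms False by (simp add: nat_dvd_not_less)
  qed
  then have "(\<Sum>k<n. (\<omega> ^ j) ^ k) = ((\<omega> ^ j) ^ n - 1) / (\<omega> ^ j - 1)" by (rule geometric_sum)
  also have "(\<omega> ^ j) ^ n = 1" using \<omega> by (metis mult.commute power_mult power_one)
  finally show ?thesis using False by (simp add: \<omega>_def power_mult[symmetric] mult.commute)
qed simp

text \<open>Put \<open>y = z b\<close>. Multiplied by \<open>1 - y^n\<close>, the inverse of
  \<open>1 - \<omega>^k y\<close> becomes the sum of \<open>(\<omega>^k y)^j\<close> over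
  \<open>j < n\<close>, and averaging over \<open>k\<close> removes every term except
  \<open>j = 0\<close>. The identity is a discrete counterpart of a contour integral of the
  resolvent.\<close>

lemma average_resolvent:
  fixes b :: "'a::cstar_algebra" and n :: nat
  assumes "0 < n" "\<And>k. k < n \<Longrightarrow> has_inverse (1 - (cis (2 * pi / n) ^ k * z) *\<^sub>C b)"
  defines "A \<equiv> (1 / of_nat n) *\<^sub>C (\<Sum>k<n. inverse_of (1 - (cis (2 * pi / n) ^ k * z) *\<^sub>C b))"
  shows "A * (1 - (z *\<^sub>C b) ^ n) = 1" "(1 - (z *\<^sub>C b) ^ n) * A = 1"
proof -
  define \<omega> where "\<omega> = cis (2 * pi / n)"
  define y where "y = z *\<^sub>C b"
  have yk: "(\<omega> ^ k * z) *\<^sub>C b = \<omega> ^ k *\<^sub>C y" for k by (simp add: y_def scaleC_scaleC)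
  have "(\<omega> ^ k) ^ n = 1" for k
    using cis_root_of_unity[OF assms(1)] unfolding \<omega>_def by (metis mult.commute power_mult power_one)
  then have pn: "(\<omega> ^ k *\<^sub>C y) ^ n = y ^ n" for k by (simp add: scaleC_power scaleC_one)
  have G: "has_inverse (1 - \<omega> ^ k *\<^sub>C y)" if "k < n" for k
    using assms(2)[OF that] by (simp add: yk \<omega>_def[symmetric])
  have l: "inverse_of (1 - \<omega> ^ k *\<^sub>C y) * (1 - y ^ n) = (\<Sum>j<n. (\<omega> ^ k *\<^sub>C y) ^ j)" if "k < n" for k
  proof -
    have "inverse_of (1 - \<omega> ^ k *\<^sub>C y) * (1 - y ^ n) =
        (inverse_of (1 - \<omega> ^ k *\<^sub>C y) * (1 - \<omega> ^ k *\<^sub>C y)) * (\<Sum>j<n. (\<omega> ^ k *\<^sub>C y) ^ j)"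
      by (simp only: mult.assoc one_minus_mult_sum_power pn)
    then show ?thesis by (simp only: inverse_of[OF G[OF that]] mult_1)
  qed
  have r: "(1 - y ^ n) * inverse_of (1 - \<omega> ^ k *\<^sub>C y) = (\<Sum>j<n. (\<omega> ^ k *\<^sub>C y) ^ j)" if "k < n" for k
  proof -
    have "(1 - y ^ n) * inverse_of (1 - \<omega> ^ k *\<^sub>C y) =
        (\<Sum>j<n. (\<omega> ^ k *\<^sub>C y) ^ j) * ((1 - \<omega> ^ k *\<^sub>C y) * inverse_of (1 - \<omega> ^ k *\<^sub>C y))"
      by (simp only: mult.assoc[symmetric] sum_power_mult_one_minus pn)
    then show ?thesis by (simp only: inverse_of[OF G[OF that]] mult.right_neutral)
  qed
  have "(\<Sum>k<n. \<Sum>j<n. (\<omega> ^ k *\<^sub>C y) ^ j) = (\<Sum>j<n. (\<Sum>k<n. (\<omega> ^ k) ^ j) *\<^sub>C y ^ j)"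
    unfolding scaleC_power scaleC_sum_left by (rule sum.swap)
  also have "\<dots> = (\<Sum>j<n. if j = 0 then of_nat n *\<^sub>C 1 else 0)"
    using assms(1) by (intro sum.cong) (auto simp: \<omega>_def sum_roots_of_unity_power scaleC_zero_left)
  also have "\<dots> = of_nat n *\<^sub>C 1" using assms(1) by simp
  finally have sum: "(1 / of_nat n) *\<^sub>C (\<Sum>k<n. \<Sum>j<n. (\<omega> ^ k *\<^sub>C y) ^ j) = 1"
    using assms(1) by (simp add: scaleC_scaleC scaleC_one)
  have A: "A = (1 / of_nat n) *\<^sub>C (\<Sum>k<n. inverse_of (1 - \<omega> ^ k *\<^sub>C y))"
    by (simp add: A_def yk \<omega>_def[symmetric])
  show "A * (1 - (z *\<^sub>C b) ^ n) = 1" unfolding A y_def[symmetric]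
    unfolding scaleC_mult_left sum_distrib_right
    by (rule trans[OF _ sum], intro arg_cong[where f = "scaleC (1 / of_nat n)"] sum.cong)
      (simp_all only: l lessThan_iff)
  show "(1 - (z *\<^sub>C b) ^ n) * A = 1" unfolding A y_def[symmetric]
    unfolding scaleC_mult_right sum_distrib_left
    by (rule trans[OF _ sum], intro arg_cong[where f = "scaleC (1 / of_nat n)"] sum.cong)
      (simp_all only: r lessThan_iff)
qed

text \<open>\<open>A - 1 = A x\<close> gives \<open>|A - 1| \<le> (|A - 1| + 1) / 4\<close>.\<close>

lemma norm_left_inverse_minus_one_le:
  fixes A x :: "'a::cstar_algebra"
  assumes "A * (1 - x) = 1" "norm x \<le> 1 / 4"
  shows "norm (A - 1) \<le> 1 / 3"
proof -
  have eq: "A - 1 = A * x" using assms(1) by (simp add: right_diff_distrib algebra_simps)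
  have "norm (A - 1) \<le> norm A * (1 / 4)"
    unfolding eq using norm_mult_ineq[of A x] mult_left_mono[OF assms(2), of "norm A"] by simp
  moreover have "norm A \<le> norm (A - 1) + 1"
    using norm_triangle_ineq[of "A - 1" 1] norm_one_le[where 'a = 'a] by simp
  ultimately show ?thesis by simp
qed

text \<open>The constant 7/12 is the 1/3 of the preceding estimate plus a variation of 1/4. From
  \<open>x = (A - 1) - (A - 1) x\<close> one even gets \<open>|x| \<le> 7/5\<close>.\<close>

lemma norm_le_if_left_inverse_near_one:
  fixes A x :: "'a::cstar_algebra"
  assumes "A * (1 - x) = 1" "norm (A - 1) \<le> 7 / 12"
  shows "norm x \<le> 2"
proof -
  have eq: "x = (A - 1) - (A - 1) * x"
    using assms(1) by (simp add: right_diff_distrib left_diff_distrib algebra_simps)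
  have "norm x \<le> norm (A - 1) + norm ((A - 1) * x)"
    by (subst eq) (rule norm_triangle_ineq4)
  also have "norm ((A - 1) * x) \<le> 7 / 12 * norm x"
    using norm_mult_ineq[of "A - 1" x] mult_right_mono[OF assms(2), of "norm x"] by simp
  finally show ?thesis using assms(2) by simp
qed

text \<open>
  The averages of the resolvent over the \<open>n\<close>-th roots of unity are \<open>(1 - t\<^sup>n b\<^sup>n)\<^sup>-\<^sup>1\<close>, and they are
  uniformly continuous in \<open>t\<close>, uniformly in \<open>n\<close>. Hence boundedness of \<open>t\<^sup>n b\<^sup>n\<close> propagates
  from \<open>t = 0\<close> in steps of fixed length as long as the resolvent exists.
\<close>

lemma eventually_norm_power_le:
  fixes b :: "'a::cstar_algebra"
  assumes "\<And>z. z \<in> spectrum b \<Longrightarrow> cmod z \<le> \<rho>" "\<rho> < \<tau>" "0 < \<tau>"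
  shows "eventually (\<lambda>n. norm (b ^ n) \<le> 2 * \<tau> ^ n) sequentially"
proof -
  \<comment> \<open>For \<open>0 < |z| \<le> T\<close> the point \<open>1 / z\<close> has modulus at
    least \<tau> and lies outside the spectrum, so \<open>1 - z b\<close> is invertible on the whole
    disc.\<close>
  define T where "T = 1 / \<tau>"
  have T: "0 < T" using assms(3) by (simp add: T_def)
  define G where "G = (\<lambda>z. inverse_of (1 - z *\<^sub>C b))"
  have inv: "has_inverse (1 - z *\<^sub>C b)" if "cmod z \<le> T" for z
  proof (cases "z = 0")
    case True
    then show ?thesis by (simp add: scaleC_zero_left has_inverse_one)
  next
    case False
    then have "\<tau> \<le> cmod (1 / z)" using that assms(3)
      by (simp add: T_def norm_divide field_simps)
    then have "1 / z \<notin> spectrum b" using assms by force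
    then have "has_inverse ((- z) *\<^sub>C (b - (1 / z) *\<^sub>C 1))"
      using False by (intro has_inverse_scaleC) (simp_all add: spectrum_iff)
    also have "(- z) *\<^sub>C (b - (1 / z) *\<^sub>C 1) = 1 - z *\<^sub>C b"
      using False by (simp add: scaleC_diff_right scaleC_scaleC scaleC_minus_left scaleC_one)
    finally show ?thesis .
  qed
  have "continuous_on (cball 0 T) G"
    unfolding G_def
    by (rule continuous_on_compose2[OF continuous_on_inverse_of])
      (auto intro!: continuous_intros bounded_bilinear.continuous_on[OF bounded_bilinear_scaleC] inv)
  then have "uniformly_continuous_on (cball 0 T) G"
    by (intro compact_uniformly_continuous) auto
  then have "\<exists>\<delta>>0. \<forall>w\<in>cball 0 T. \<forall>z\<in>cball 0 T. dist z w < \<delta> \<longrightarrow> dist (G z) (G w) < 1 / 4"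
    unfolding uniformly_continuous_on_def by (rule allE[where x = "1 / 4"]) simp
  then obtain \<delta> where \<delta>: "0 < \<delta>"
    "\<And>z w. cmod z \<le> T \<Longrightarrow> cmod w \<le> T \<Longrightarrow> dist z w < \<delta> \<Longrightarrow> dist (G z) (G w) < 1 / 4"
    by (auto simp del: dist_0_norm simp: dist_0_norm[symmetric])
  define A where "A = (\<lambda>n t. (1 / of_nat n) *\<^sub>C (\<Sum>k<n. G (cis (2 * pi / real n) ^ k * complex_of_real t)))"
  have cm: "cmod (cis \<theta> ^ k * complex_of_real t) = \<bar>t\<bar>" for \<theta> k t
    by (simp add: norm_mult norm_power)
  have A_inv: "A n t * (1 - t ^ n *\<^sub>R b ^ n) = 1" if "0 < n" "0 \<le> t" "t \<le> T" for n t
  proof -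
    have "(complex_of_real t *\<^sub>C b) ^ n = t ^ n *\<^sub>R b ^ n"
      by (simp add: scaleC_power flip: scaleC_of_real)
    moreover have "A n t * (1 - (complex_of_real t *\<^sub>C b) ^ n) = 1"
      unfolding A_def G_def using that by (intro average_resolvent inv) (simp_all add: cm)
    ultimately show ?thesis by simp
  qed
  \<comment> \<open>Rotation by a root of unity preserves the distance of \<open>t\<close> and
    \<open>t'\<close>, so the averages inherit the modulus of continuity of \<open>G\<close>, with a
    \<delta> that does not depend on \<open>n\<close>.\<close>
  have A_near: "norm (A n t - A n t') \<le> 1 / 4"
    if "0 < n" "0 \<le> t" "t \<le> T" "0 \<le> t'" "t' \<le> T" "\<bar>t - t'\<bar> < \<delta>" for n t t'
  proof -
    have "norm (A n t - A n t') = (1 / real n) * norm (\<Sum>k<n. G (cis (2 * pi / real n) ^ k * t) - G (cis (2 * pi / real n) ^ k * t'))"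
      by (simp add: A_def norm_scaleC norm_divide sum_subtractf flip: scaleC_diff_right)
    also have "\<dots> \<le> (1 / real n) * (\<Sum>k<n. 1 / 4)"
    proof (intro mult_left_mono sum_norm_le)
      fix k
      have "dist (cis (2 * pi / real n) ^ k * complex_of_real t) (cis (2 * pi / real n) ^ k * complex_of_real t') = \<bar>t - t'\<bar>"
        unfolding dist_norm right_diff_distrib[symmetric] of_real_diff[symmetric] by (rule cm)
      then show "norm (G (cis (2 * pi / real n) ^ k * t) - G (cis (2 * pi / real n) ^ k * t')) \<le> 1 / 4"
        using \<delta>(2)[of "cis (2 * pi / real n) ^ k * t" "cis (2 * pi / real n) ^ k * t'"] that
        by (simp add: cm dist_norm[of "G _"])
    qed simp
    also have "\<dots> = 1 / 4" using that(1) by simp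
    finally show ?thesis .
  qed
  define B where "B = (\<lambda>t. eventually (\<lambda>n. norm (t ^ n *\<^sub>R b ^ n) \<le> 2) sequentially)"
  \<comment> \<open>First step back from \<open>t\<close> to \<open>s\<close>: there
    \<open>(s / t) ^ n\<close>, or \<open>0 ^ n\<close> if \<open>s = 0\<close>, brings the bound
    down to 1/4, so the average at \<open>s\<close> is within 1/3 of 1. Then move forward to
    \<open>t'\<close>, less than \<delta> away from \<open>s\<close>, which changes the average by
    at most 1/4.\<close>
  have step: "B t'" if B: "B t" and t: "0 \<le> t" "t \<le> T" "t \<le> t'" "t' \<le> T" "t' - t < \<delta> / 2" for t t'
  proof -
    define s where "s = max 0 (t - \<delta> / 4)"
    have s: "0 \<le> s" "s \<le> T" "\<bar>t' - s\<bar> < \<delta>" using t \<delta>(1) by (auto simp: s_def)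
    have "eventually (\<lambda>n. norm (s ^ n *\<^sub>R b ^ n) \<le> 1 / 4) sequentially"
    proof (cases "s = 0")
      case True
      then show ?thesis by (intro eventually_sequentiallyI[of 1]) (simp add: power_0_left)
    next
      case False
      then have st: "0 < s" "s < t" using \<delta>(1) by (auto simp: s_def)
      then have "(\<lambda>n. (s / t) ^ n) \<longlonglongrightarrow> 0" by (intro LIMSEQ_realpow_zero) auto
      then have "eventually (\<lambda>n. (s / t) ^ n < 1 / 8) sequentially" by (rule order_tendstoD) simp
      with B[unfolded B_def] show ?thesis
      proof eventually_elim
        case (elim n)
        have "norm (s ^ n *\<^sub>R b ^ n) = (s / t) ^ n * norm (t ^ n *\<^sub>R b ^ n)"
          using st by (simp add: power_divide)
        also have "\<dots> \<le> 1 / 8 * 2" using elim st by (intro mult_mono) auto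
        finally show ?case by simp
      qed
    qed
    with eventually_gt_at_top[of 0] show "B t'" unfolding B_def
    proof eventually_elim
      case (elim n)
      have "norm (A n s - 1) \<le> 1 / 3"
        using A_inv[of n s] s elim by (intro norm_left_inverse_minus_one_le) auto
      moreover have "norm (A n t' - A n s) \<le> 1 / 4" using s t elim by (intro A_near) auto
      ultimately have "norm (A n t' - 1) \<le> 7 / 12"
        using norm_triangle_ineq[of "A n t' - A n s" "A n s - 1"] by simp
      then show ?case using A_inv[of n t'] t elim by (intro norm_le_if_left_inverse_near_one) auto
    qed
  qed
  \<comment> \<open>Steps of length \<open>\<delta> / 3 < \<delta> / 2\<close> lead from 0, where
    the powers vanish for \<open>n \<ge> 1\<close>, up to \<open>T\<close>.\<close>
  have "B (min T (real k * (\<delta> / 3)))" for k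
  proof (induction k)
    case 0
    then show ?case unfolding B_def using T by (intro eventually_sequentiallyI[of 1]) (simp add: power_0_left)
  next
    case (Suc k)
    show ?case by (rule step[OF Suc.IH]) (use T \<delta>(1) in \<open>auto simp: min_def algebra_simps\<close>)
  qed
  moreover obtain k where "T / (\<delta> / 3) < real k" using reals_Archimedean2 by blast
  then have "min T (real k * (\<delta> / 3)) = T" using \<delta>(1) by (simp add: min_def field_simps)
  ultimately have "B T" by metis
  then show ?thesis unfolding B_def
  proof eventually_elim
    case (elim n)
    then show ?case using assms(3) by (simp add: T_def power_divide field_simps)
  qed
qed

lemma norm_power_self_adjoint:
  fixes b :: "'a::cstar_algebra"
  assumes "star b = b"
  shows "norm (b ^ 2 ^ k) = norm b ^ 2 ^ k"
proof (induction k)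
  case (Suc k)
  have "norm (b ^ 2 ^ Suc k) = norm (star (b ^ 2 ^ k) * b ^ 2 ^ k)"
    by (simp add: star_power assms power_add[symmetric] mult_2)
  also have "\<dots> = (norm b ^ 2 ^ k)\<^sup>2" unfolding norm_star_mult_self Suc ..
  finally show ?case by (simp add: power_mult[symmetric] mult.commute)
qed simp

text \<open>The C*-identity gives \<open>|b^n| = |b|^n\<close> for \<open>n = 2^k\<close>. If
  \<open>|b| > \<tau> > \<rho>\<close>, this contradicts the bound \<open>2 \<tau>^n\<close> for
  large \<open>n\<close>.\<close>

lemma norm_self_adjoint_le:
  fixes b :: "'a::cstar_algebra"
  assumes "star b = b" "\<And>z. z \<in> spectrum b \<Longrightarrow> cmod z \<le> \<rho>" "0 \<le> \<rho>"
  shows "norm b \<le> \<rho>"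
proof (rule dense_ge)
  fix \<tau> assume "\<rho> < \<tau>"
  then have \<tau>: "0 < \<tau>" using assms(3) by simp
  show "norm b \<le> \<tau>"
  proof (rule ccontr)
    assume "\<not> norm b \<le> \<tau>"
    then have "1 < norm b / \<tau>" using \<tau> by simp
    then obtain n\<^sub>0 where n0: "3 < (norm b / \<tau>) ^ n\<^sub>0" using real_arch_pow by blast
    have "3 \<le> (norm b / \<tau>) ^ n" if "n\<^sub>0 \<le> n" for n
      using power_increasing[OF that, of "norm b / \<tau>"] n0 \<open>1 < norm b / \<tau>\<close> by linarith
    then have "eventually (\<lambda>n. 3 \<le> (norm b / \<tau>) ^ n) sequentially"
      unfolding eventually_sequentially by blast
    then have "eventually (\<lambda>n. 3 \<le> (norm b / \<tau>) ^ n \<and> norm (b ^ n) \<le> 2 * \<tau> ^ n) sequentially"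
      using eventually_norm_power_le[OF assms(2) \<open>\<rho> < \<tau>\<close> \<tau>] by (rule eventually_conj)
    then obtain N where N: "\<And>n. N \<le> n \<Longrightarrow> 3 \<le> (norm b / \<tau>) ^ n \<and> norm (b ^ n) \<le> 2 * \<tau> ^ n"
      unfolding eventually_sequentially by blast
    \<comment> \<open>The exponent \<open>2 ^ N\<close> is a power of two beyond \<open>N\<close>,
      so both growth estimates apply to it.\<close>
    have "N \<le> 2 ^ N" by (simp add: less_imp_le)
    from N[OF this] have "3 * \<tau> ^ 2 ^ N \<le> norm b ^ 2 ^ N" "norm b ^ 2 ^ N \<le> 2 * \<tau> ^ 2 ^ N"
      using \<tau> by (simp_all add: norm_power_self_adjoint[OF assms(1)] power_divide field_simps)
    moreover have "0 < \<tau> ^ 2 ^ N" using \<tau> by simp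
    ultimately show False by linarith
  qed
qed

section \<open>The continuous functional calculus\<close>

definition aeval :: "'a::cstar_algebra \<Rightarrow> complex poly \<Rightarrow> 'a" where
  "aeval a p = (\<Sum>i\<le>degree p. coeff p i *\<^sub>C a ^ i)"

lemma aeval_altdef: "degree p \<le> n \<Longrightarrow> aeval a p = (\<Sum>i\<le>n. coeff p i *\<^sub>C a ^ i)"
  unfolding aeval_def by (rule sum.mono_neutral_left) (auto simp: coeff_eq_0 scaleC_zero_left)

lemma aeval_0: "aeval a 0 = 0"
  by (simp add: aeval_def scaleC_zero_left)

lemma aeval_add: "aeval a (p + q) = aeval a p + aeval a q"
proof -
  let ?n = "max (degree p) (degree q)"
  have "aeval a (p + q) = (\<Sum>i\<le>?n. coeff (p + q) i *\<^sub>C a ^ i)"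
    by (rule aeval_altdef) (rule degree_add_le_max)
  then show ?thesis
    by (simp add: aeval_altdef[of p ?n] aeval_altdef[of q ?n] scaleC_add_left sum.distrib)
qed

lemma aeval_pCons: "aeval a (pCons c p) = c *\<^sub>C 1 + a * aeval a p"
proof -
  have "aeval a (pCons c p) = (\<Sum>i\<le>Suc (degree p). coeff (pCons c p) i *\<^sub>C a ^ i)"
    by (rule aeval_altdef) (rule degree_pCons_le)
  also have "\<dots> = c *\<^sub>C 1 + a * aeval a p"
    unfolding aeval_def by (simp add: sum.atMost_Suc_shift sum_distrib_left scaleC_mult_right
        del: sum.atMost_Suc)
  finally show ?thesis .
qed

lemma aeval_smult: "aeval a (smult c p) = c *\<^sub>C aeval a p"
  by (induction p) (simp_all add: aeval_0 aeval_pCons scaleC_zero_right scaleC_add_right scaleC_scaleC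
      scaleC_mult_right mult.commute[of c])

lemma aeval_mult: "aeval a (p * q) = aeval a p * aeval a q"
  by (induction p) (simp_all add: aeval_0 aeval_pCons aeval_add aeval_smult scaleC_zero_left
      distrib_right scaleC_mult_left mult.assoc)

lemma aeval_minus: "aeval a (- p) = - aeval a p"
  using aeval_smult[of a "-1" p] by (simp add: scaleC_minus_left scaleC_one)

lemma aeval_diff: "aeval a (p - q) = aeval a p - aeval a q"
  using aeval_add[of a p "- q"] by (simp add: aeval_minus)

lemma star_aeval: "star (aeval a p) = aeval (star a) (map_poly cnj p)"
proof -
  have "star (aeval a p) = (\<Sum>i\<le>degree p. cnj (coeff p i) *\<^sub>C star a ^ i)"
    by (simp add: aeval_def star_sum star_scaleC star_power)
  also have "\<dots> = aeval (star a) (map_poly cnj p)"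
    by (subst aeval_altdef[of _ "degree p"]) (simp_all add: degree_map_poly coeff_map_poly)
  finally show ?thesis .
qed

text \<open>The fundamental theorem of algebra splits off linear factors, each invertible at
  \<open>a\<close> because its root lies outside the spectrum.\<close>

lemma has_inverse_aeval:
  assumes "p \<noteq> 0" "\<And>z. poly p z = 0 \<Longrightarrow> z \<notin> spectrum a"
  shows "has_inverse (aeval a p)"
  using assms
proof (induction "degree p" arbitrary: p)
  case 0
  then obtain c where "p = [:c:]" "c \<noteq> 0" by (metis degree_eq_zeroE pCons_eq_0_iff)
  then show ?case by (simp add: aeval_pCons aeval_0 has_inverse_scaleC has_inverse_one)
next
  case (Suc n)
  then have "\<not> constant (poly p)" by (simp add: constant_degree)
  then obtain z where z: "poly p z = 0" using fundamental_theorem_of_algebra by blast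
  then obtain q where q: "p = [:- z, 1:] * q" by (auto simp: poly_eq_0_iff_dvd dvd_def)
  with Suc have "q \<noteq> 0" by auto
  then have "degree p = Suc (degree q)" unfolding q by (subst degree_mult_eq) auto
  then have "has_inverse (aeval a q)" using Suc q \<open>q \<noteq> 0\<close> by auto
  moreover have "has_inverse (aeval a [:- z, 1:])"
    using Suc(4)[OF z] by (simp add: spectrum_iff aeval_pCons aeval_0 scaleC_minus_left scaleC_one
        scaleC_zero_left)
  ultimately show ?case unfolding q aeval_mult by (rule has_inverse_mult[rotated])
qed

text \<open>This settles the zero algebra: an empty spectrum forces \<open>a = 0\<close> by the norm
  bound, then 0 is invertible, so \<open>1 = 0\<close> and every \<open>b\<close> vanishes.\<close>

lemma eq_zero_if_spectrum_empty:
  fixes a b :: "'a::cstar_algebra"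
  assumes "star a = a" "spectrum a = {}"
  shows "b = 0"
proof -
  have "norm a \<le> 0" using norm_self_adjoint_le[OF assms(1), of 0] assms(2) by simp
  then have "a = 0" by simp
  then have "has_inverse (0 :: 'a)" using assms(2) spectrum_iff[of 0 a] by (auto simp: scaleC_zero_left)
  then obtain c :: 'a where "c * 0 = 1" unfolding has_inverse_def by (elim exE conjE)
  then have "(1 :: 'a) = 0" by (simp only: mult_zero_right)
  then have "1 * b = 0 * b" by (rule arg_cong)
  then show "b = 0" by simp
qed

text \<open>If \<open>p\<close> omits the value \<open>z\<close> on the spectrum, then
  \<open>p - z\<close> has no root there; as the spectrum has a point, \<open>p - z\<close> is also
  not the zero polynomial, and \<open>has_inverse_aeval\<close> applies.\<close>

lemma spectrum_aeval:
  assumes "spectrum a \<noteq> {}" "z \<in> spectrum (aeval a p)"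
  shows "\<exists>w\<in>spectrum a. z = poly p w"
proof (rule ccontr)
  assume *: "\<not> (\<exists>w\<in>spectrum a. z = poly p w)"
  have "has_inverse (aeval a (p - [:z:]))"
  proof (rule has_inverse_aeval)
    show "p - [:z:] \<noteq> 0" using assms(1) * by (metis all_not_in_conv poly_const_conv eq_iff_diff_eq_0 poly_pCons poly_0 mult_zero_right add.right_neutral)
  qed (use * in auto)
  then show False using assms(2)
    by (simp add: aeval_diff aeval_pCons aeval_0 spectrum_iff)
qed

text \<open>By the C*-identity it suffices to bound the self-adjoint element
  \<open>aeval a q\<close>. Since the spectrum of \<open>a\<close> is real, that of
  \<open>aeval a q\<close> lies in the set of values \<open>|p(w)|^2\<close>.\<close>

lemma norm_aeval_le:
  fixes a :: "'a::cstar_algebra"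
  assumes a: "star a = a" "spectrum a \<subseteq> \<real>" and B: "\<And>z. z \<in> spectrum a \<Longrightarrow> cmod (poly p z) \<le> B" "0 \<le> B"
  shows "norm (aeval a p) \<le> B"
proof (cases "spectrum a = {}")
  case True
  then show ?thesis using eq_zero_if_spectrum_empty[OF a(1), of "aeval a p"] B by simp
next
  case False
  define q where "q = map_poly cnj p * p"
  have aq: "star (aeval a p) * aeval a p = aeval a q"
    by (simp add: q_def aeval_mult star_aeval a)
  have "norm (aeval a q) \<le> B\<^sup>2"
  proof (rule norm_self_adjoint_le)
    show "star (aeval a q) = aeval a q" by (simp add: star_mult star_star flip: aq)
    fix z assume "z \<in> spectrum (aeval a q)"
    from spectrum_aeval[OF False this] obtain w where w: "w \<in> spectrum a" "z = poly q w" by blast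
    then have "cnj w = w" using a(2) by (auto simp: Reals_cnj_iff)
    then have "cmod z = (cmod (poly p w))\<^sup>2"
      by (simp add: w(2) q_def norm_mult power2_eq_square)
    then show "cmod z \<le> B\<^sup>2" using B(1)[OF w(1)] by (simp add: power_mono)
  qed simp
  then have "(norm (aeval a p))\<^sup>2 \<le> B\<^sup>2" by (simp add: norm_star_mult_self flip: aq)
  then show ?thesis using B(2) by (rule power2_le_imp_le)
qed

section \<open>Polynomial approximation and passage to continuous functions\<close>

lemma poly_approximation_on_reals:
  fixes f :: "complex \<Rightarrow> complex"
  assumes "compact S" "S \<subseteq> \<real>" "continuous_on S f" "0 < e"
  shows "\<exists>p. \<forall>z\<in>S. cmod (poly p z - f z) < e"
proof -
  \<comment> \<open>The real Stone-Weierstrass theorem is used for the real and the imaginary part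
    of \<open>f\<close> separately.\<close>
  have approx: "\<exists>p. \<forall>z\<in>S. cmod (poly p z - of_real (g z)) < e / 2"
    if g: "continuous_on S g" for g :: "complex \<Rightarrow> real"
  proof -
    have of_real_Re: "complex_of_real (Re z) = z" if "z \<in> S" for z
      using that assms(2) by (auto simp: complex_is_Real_iff complex_eq_iff)
    have 1: "compact (Re ` S)"
      using assms(1) by (intro compact_continuous_image continuous_intros)
    have 2: "continuous_on (Re ` S) (\<lambda>x. g (of_real x))"
      by (rule continuous_on_compose2[OF g]) (auto intro!: continuous_intros simp: of_real_Re)
    have 3: "0 < e / 2" using assms(4) by simp
    obtain h where h: "real_polynomial_function h" "\<And>x. x \<in> Re ` S \<Longrightarrow> \<bar>g (of_real x) - h x\<bar> < e / 2"
      using Stone_Weierstrass_real_polynomial_function[OF 1 2 3] by metis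
    then obtain c n where c: "h = (\<lambda>x. \<Sum>i\<le>n. c i * x ^ i)"
      by (auto simp: real_polynomial_function_iff_sum)
    define p where "p = (\<Sum>i\<le>n. monom (complex_of_real (c i)) i)"
    have "poly p (of_real x) = of_real (h x)" for x
      by (simp add: p_def c poly_sum poly_monom)
    then have "poly p z - of_real (g z) = of_real (h (Re z) - g z)" if "z \<in> S" for z
      using of_real_Re[OF that] by (metis of_real_diff)
    moreover have "\<bar>h (Re z) - g z\<bar> < e / 2" if "z \<in> S" for z
      using h(2)[of "Re z"] that of_real_Re[OF that] by (simp add: abs_minus_commute)
    ultimately show ?thesis by (intro exI[of _ p]) (simp del: of_real_diff)
  qed
  obtain p where p: "\<forall>z\<in>S. cmod (poly p z - of_real (Re (f z))) < e / 2"
    using approx[of "\<lambda>z. Re (f z)"] assms(3) by (auto intro: continuous_intros)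
  obtain q where q: "\<forall>z\<in>S. cmod (poly q z - of_real (Im (f z))) < e / 2"
    using approx[of "\<lambda>z. Im (f z)"] assms(3) by (auto intro: continuous_intros)
  have "cmod (poly (p + smult \<i> q) z - f z) < e" if "z \<in> S" for z
  proof -
    have "poly (p + smult \<i> q) z - f z = (poly p z - of_real (Re (f z))) + \<i> * (poly q z - of_real (Im (f z)))"
      by (simp add: algebra_simps complex_eq_iff)
    also have "cmod \<dots> \<le> cmod (poly p z - of_real (Re (f z))) + cmod (poly q z - of_real (Im (f z)))"
      by (rule order.trans[OF norm_triangle_ineq]) (simp add: norm_mult)
    also have "\<dots> < e / 2 + e / 2" using p q that by (intro add_strict_mono) auto
    finally show ?thesis by simp
  qed
  then show ?thesis by blast
qed

text \<open>The graph of the extension of \<open>aeval a\<close> by uniform limits. As a relation it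
  separates the existence of a value from its independence of the approximating sequence.\<close>

definition calculus_limit :: "'a::cstar_algebra \<Rightarrow> (complex \<Rightarrow> complex) \<Rightarrow> 'a \<Rightarrow> bool" where
  "calculus_limit a f x \<longleftrightarrow> (\<exists>p. uniform_limit (spectrum a) (\<lambda>n. poly (p n)) f sequentially \<and>
     (\<lambda>n. aeval a (p n)) \<longlonglongrightarrow> x)"

lemma exists_poly_uniform_limit:
  assumes "spectrum a \<subseteq> \<real>" "continuous_on (spectrum a) f"
  shows "\<exists>p. \<forall>n. \<forall>z\<in>spectrum a. cmod (poly (p n) z - f z) < 1 / real (Suc n)"
  using poly_approximation_on_reals[OF compact_spectrum assms] by (intro choice allI) simp

lemma uniform_limit_if_dist_less:
  assumes "\<And>n z. z \<in> S \<Longrightarrow> cmod (g n z - f z) < 1 / real (Suc n)"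
  shows "uniform_limit S g f sequentially"
proof (rule uniform_limitI)
  fix e :: real assume "0 < e"
  then have "eventually (\<lambda>n. 1 / real (Suc n) < e) sequentially"
    using order_tendstoD(2)[OF lim_1_over_n[THEN LIMSEQ_Suc], of e] by simp
  then show "eventually (\<lambda>n. \<forall>z\<in>S. dist (g n z) (f z) < e) sequentially"
    by eventually_elim (auto simp: dist_norm intro: less_trans[OF assms])
qed

text \<open>By \<open>norm_aeval_le\<close>, uniformly Cauchy polynomials on the spectrum give a
  Cauchy sequence in the algebra.\<close>

lemma calculus_limit_exists:
  assumes "star a = a" "spectrum a \<subseteq> \<real>" "continuous_on (spectrum a) f"
  shows "\<exists>x. calculus_limit a f x"
proof -
  obtain p where p: "\<And>n z. z \<in> spectrum a \<Longrightarrow> cmod (poly (p n) z - f z) < 1 / real (Suc n)"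
    using exists_poly_uniform_limit[OF assms(2,3)] by blast
  then have lim: "uniform_limit (spectrum a) (\<lambda>n. poly (p n)) f sequentially"
    by (rule uniform_limit_if_dist_less)
  have "Cauchy (\<lambda>n. aeval a (p n))"
  proof (rule metric_CauchyI)
    fix e :: real assume "0 < e"
    then have "0 < e / 4" by simp
    from uniform_limitD[OF lim this] obtain N where N: "\<And>n z. N \<le> n \<Longrightarrow> z \<in> spectrum a \<Longrightarrow> dist (poly (p n) z) (f z) < e / 4"
      unfolding eventually_sequentially by blast
    have "dist (aeval a (p m)) (aeval a (p n)) < e" if "N \<le> m" "N \<le> n" for m n
    proof -
      have "norm (aeval a (p m - p n)) \<le> e / 2"
      proof (rule norm_aeval_le[OF assms(1,2)])
        fix z assume z: "z \<in> spectrum a"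
        have "dist (poly (p m) z) (poly (p n) z) < e / 2"
          using N[OF that(1) z] N[OF that(2) z] by metric
        then show "cmod (poly (p m - p n) z) \<le> e / 2" by (simp add: dist_norm)
      qed (use \<open>0 < e\<close> in simp)
      then show ?thesis using \<open>0 < e\<close> by (simp add: dist_norm aeval_diff)
    qed
    then show "\<exists>N. \<forall>m\<ge>N. \<forall>n\<ge>N. dist (aeval a (p m)) (aeval a (p n)) < e" by blast
  qed
  then obtain x where "(\<lambda>n. aeval a (p n)) \<longlonglongrightarrow> x"
    using Cauchy_convergent convergent_def by blast
  with lim show ?thesis unfolding calculus_limit_def by blast
qed

text \<open>Allowing two functions covers both the choice of the polynomials and the choice of the
  extension off the spectrum.\<close>

lemma calculus_limit_unique:
  assumes a: "star a = a" "spectrum a \<subseteq> \<real>"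
    and "calculus_limit a f x" "calculus_limit a g y" "\<And>z. z \<in> spectrum a \<Longrightarrow> f z = g z"
  shows "x = y"
proof -
  obtain p where p: "uniform_limit (spectrum a) (\<lambda>n. poly (p n)) f sequentially"
    "(\<lambda>n. aeval a (p n)) \<longlonglongrightarrow> x" using assms(3) unfolding calculus_limit_def by blast
  obtain q where q: "uniform_limit (spectrum a) (\<lambda>n. poly (q n)) g sequentially"
    "(\<lambda>n. aeval a (q n)) \<longlonglongrightarrow> y" using assms(4) unfolding calculus_limit_def by blast
  have "(\<lambda>n. aeval a (p n) - aeval a (q n)) \<longlonglongrightarrow> 0"
  proof (rule tendstoI)
    fix e :: real assume "0 < e"
    then have "0 < e / 4" by simp
    from uniform_limitD[OF p(1) this] uniform_limitD[OF q(1) this]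
    show "eventually (\<lambda>n. dist (aeval a (p n) - aeval a (q n)) 0 < e) sequentially"
    proof eventually_elim
      case (elim n)
      have "norm (aeval a (p n - q n)) \<le> e / 2"
      proof (rule norm_aeval_le[OF a])
        fix z assume z: "z \<in> spectrum a"
        have "dist (poly (p n) z) (f z) < e / 4" "dist (poly (q n) z) (f z) < e / 4"
          using elim z assms(5)[OF z] by auto
        then have "dist (poly (p n) z) (poly (q n) z) < e / 2" by metric
        then show "cmod (poly (p n - q n) z) \<le> e / 2" by (simp add: dist_norm)
      qed (use \<open>0 < e\<close> in simp)
      then show ?case using \<open>0 < e\<close> by (simp add: aeval_diff)
    qed
  qed
  moreover have "(\<lambda>n. aeval a (p n) - aeval a (q n)) \<longlonglongrightarrow> x - y"
    using p(2) q(2) by (rule tendsto_diff)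
  ultimately show "x = y" using LIMSEQ_unique by fastforce
qed

lemma calculus_limit_aeval: "calculus_limit a (poly p) (aeval a p)"
  unfolding calculus_limit_def by (intro exI[of _ "\<lambda>_. p"]) (simp add: uniform_limit_const)

lemma poly_add_fun: "poly (p + q) = (\<lambda>z. poly p z + poly q z)"
  by auto

lemma poly_mult_fun: "poly (p * q) = (\<lambda>z. poly p z * poly q z)"
  by auto

lemma poly_pCons_fun: "poly (pCons c p) = (\<lambda>z. c + z * poly p z)"
  by auto

lemma calculus_limit_add:
  assumes "calculus_limit a f x" "calculus_limit a g y"
  shows "calculus_limit a (\<lambda>z. f z + g z) (x + y)"
proof -
  obtain p q where "uniform_limit (spectrum a) (\<lambda>n. poly (p n)) f sequentially"
    "(\<lambda>n. aeval a (p n)) \<longlonglongrightarrow> x" "uniform_limit (spectrum a) (\<lambda>n. poly (q n)) g sequentially"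
    "(\<lambda>n. aeval a (q n)) \<longlonglongrightarrow> y" using assms unfolding calculus_limit_def by blast
  then have "uniform_limit (spectrum a) (\<lambda>n. poly (p n + q n)) (\<lambda>z. f z + g z) sequentially"
    "(\<lambda>n. aeval a (p n + q n)) \<longlonglongrightarrow> x + y"
    by (simp_all add: poly_add_fun aeval_add tendsto_add uniform_limit_add)
  then show ?thesis unfolding calculus_limit_def
    by (intro exI[of _ "\<lambda>n. p n + q n"] conjI)
qed

lemma calculus_limit_mult:
  assumes "continuous_on (spectrum a) f" "continuous_on (spectrum a) g"
    "calculus_limit a f x" "calculus_limit a g y"
  shows "calculus_limit a (\<lambda>z. f z * g z) (x * y)"
proof -
  have bdd: "bounded (f ` spectrum a)" "bounded (g ` spectrum a)"
    using assms(1,2) compact_spectrum by (blast intro: compact_imp_bounded compact_continuous_image)+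
  obtain p q where "uniform_limit (spectrum a) (\<lambda>n. poly (p n)) f sequentially"
    "(\<lambda>n. aeval a (p n)) \<longlonglongrightarrow> x" "uniform_limit (spectrum a) (\<lambda>n. poly (q n)) g sequentially"
    "(\<lambda>n. aeval a (q n)) \<longlonglongrightarrow> y" using assms(3,4) unfolding calculus_limit_def by blast
  then have "uniform_limit (spectrum a) (\<lambda>n. poly (p n * q n)) (\<lambda>z. f z * g z) sequentially"
    "(\<lambda>n. aeval a (p n * q n)) \<longlonglongrightarrow> x * y"
    using bdd by (simp_all add: poly_mult_fun aeval_mult tendsto_mult uniform_lim_mult)
  then show ?thesis unfolding calculus_limit_def
    by (intro exI[of _ "\<lambda>n. p n * q n"] conjI)
qed

text \<open>On a real spectrum, conjugating the coefficients of a polynomial conjugates its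
  values.\<close>

lemma calculus_limit_cnj:
  assumes a: "star a = a" "spectrum a \<subseteq> \<real>" and "calculus_limit a f x"
  shows "calculus_limit a (\<lambda>z. cnj (f z)) (star x)"
proof -
  obtain p where p: "uniform_limit (spectrum a) (\<lambda>n. poly (p n)) f sequentially"
    "(\<lambda>n. aeval a (p n)) \<longlonglongrightarrow> x" using assms(3) unfolding calculus_limit_def by blast
  have real: "cnj z = z" if "z \<in> spectrum a" for z using that a(2) by (auto simp: Reals_cnj_iff)
  have "uniform_limit (spectrum a) (\<lambda>n. poly (map_poly cnj (p n))) (\<lambda>z. cnj (f z)) sequentially"
    using bounded_linear.uniform_limit[OF bounded_linear_cnj p(1)]
    by (rule uniform_limit_cong'[THEN iffD1, rotated 2]) (simp_all add: real)
  moreover have "(\<lambda>n. aeval a (map_poly cnj (p n))) \<longlonglongrightarrow> star x"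
    using bounded_linear.tendsto[OF bounded_linear_star p(2)] by (simp add: star_aeval a)
  ultimately show ?thesis unfolding calculus_limit_def by (intro exI[of _ "\<lambda>n. map_poly cnj (p n)"]) simp
qed

lemma functional_calculus_exists:
  assumes a: "star a = a" "spectrum a \<subseteq> \<real>"
  shows "\<exists>\<pi>. is_functional_calculus a \<pi>"
proof -
  define \<pi> where "\<pi> = (\<lambda>f. SOME x. calculus_limit a f x)"
  have \<pi>: "calculus_limit a f (\<pi> f)" if "continuous_on (spectrum a) f" for f
    unfolding \<pi>_def using calculus_limit_exists[OF a that] by (rule someI_ex)
  have eq: "\<pi> f = x" if "continuous_on (spectrum a) f" "calculus_limit a f x" for f x
    using calculus_limit_unique[OF a \<pi>[OF that(1)] that(2)] by simp
  have const: "calculus_limit a (\<lambda>z. c) (c *\<^sub>C 1)" for c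
    using calculus_limit_aeval[of a "[:c:]"] by (simp add: aeval_pCons aeval_0 poly_pCons_fun del: poly_pCons)
  have "is_functional_calculus a \<pi>"
    unfolding is_functional_calculus_def Let_def
  proof (intro conjI allI impI)
    fix f g :: "complex \<Rightarrow> complex"
    assume f: "continuous_on (spectrum a) f" and g: "continuous_on (spectrum a) g"
    show "\<pi> f = \<pi> g" if "\<forall>z\<in>spectrum a. f z = g z"
      using calculus_limit_unique[OF a \<pi>[OF f] \<pi>[OF g]] that by simp
    show "\<pi> (\<lambda>z. f z + g z) = \<pi> f + \<pi> g"
      using f g by (intro eq calculus_limit_add \<pi> continuous_intros)
    show "\<pi> (\<lambda>z. f z * g z) = \<pi> f * \<pi> g"
      using f g by (intro eq calculus_limit_mult \<pi> continuous_intros)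
  next
    fix c and f :: "complex \<Rightarrow> complex" assume f: "continuous_on (spectrum a) f"
    \<comment> \<open>A scalar multiple is treated as a product with a constant function.\<close>
    have "calculus_limit a (\<lambda>z. c * f z) ((c *\<^sub>C 1) * \<pi> f)"
      using f by (intro calculus_limit_mult const \<pi> continuous_intros)
    then show "\<pi> (\<lambda>z. c * f z) = c *\<^sub>C \<pi> f"
      using f by (intro eq continuous_intros) (simp_all add: scaleC_mult_left)
  next
    fix f :: "complex \<Rightarrow> complex" assume f: "continuous_on (spectrum a) f"
    show "\<pi> (\<lambda>z. cnj (f z)) = star (\<pi> f)"
      using f by (intro eq calculus_limit_cnj a \<pi> continuous_intros)
  next
    show "\<pi> (\<lambda>z. 1) = 1" using const[of 1] by (intro eq continuous_intros) (simp add: scaleC_one)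
    have "calculus_limit a (\<lambda>z. z) a"
      using calculus_limit_aeval[of a "[:0, 1:]"]
      by (simp add: aeval_pCons aeval_0 poly_pCons_fun scaleC_zero_left scaleC_zero_right scaleC_one
          del: poly_pCons)
    then show "\<pi> (\<lambda>z. z) = a" by (intro eq continuous_intros)
  qed
  then show ?thesis by blast
qed

section \<open>Spectral inclusion, contractivity and uniqueness of the functional calculus\<close>

lemma
  assumes "is_functional_calculus a \<pi>"
  shows functional_calculus_cong: "\<And>f g. continuous_on (spectrum a) f \<Longrightarrow> continuous_on (spectrum a) g \<Longrightarrow>
      (\<And>z. z \<in> spectrum a \<Longrightarrow> f z = g z) \<Longrightarrow> \<pi> f = \<pi> g"
    and functional_calculus_add: "\<And>f g. continuous_on (spectrum a) f \<Longrightarrow> continuous_on (spectrum a) g \<Longrightarrow>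
      \<pi> (\<lambda>z. f z + g z) = \<pi> f + \<pi> g"
    and functional_calculus_mult: "\<And>f g. continuous_on (spectrum a) f \<Longrightarrow> continuous_on (spectrum a) g \<Longrightarrow>
      \<pi> (\<lambda>z. f z * g z) = \<pi> f * \<pi> g"
    and functional_calculus_scale: "\<And>c f. continuous_on (spectrum a) f \<Longrightarrow> \<pi> (\<lambda>z. c * f z) = c *\<^sub>C \<pi> f"
    and functional_calculus_cnj: "\<And>f. continuous_on (spectrum a) f \<Longrightarrow> \<pi> (\<lambda>z. cnj (f z)) = star (\<pi> f)"
    and functional_calculus_one: "\<pi> (\<lambda>z. 1) = 1"
    and functional_calculus_id: "\<pi> (\<lambda>z. z) = a"
  using assms unfolding is_functional_calculus_def Let_def by blast+

lemma functional_calculus_const: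
  assumes "is_functional_calculus a \<pi>"
  shows "\<pi> (\<lambda>z. c) = c *\<^sub>C 1"
  using functional_calculus_scale[OF assms, of "\<lambda>_. 1" c] functional_calculus_one[OF assms] by simp

lemma functional_calculus_diff:
  assumes "is_functional_calculus a \<pi>" "continuous_on (spectrum a) f" "continuous_on (spectrum a) g"
  shows "\<pi> (\<lambda>z. f z - g z) = \<pi> f - \<pi> g"
proof -
  have "\<pi> (\<lambda>z. f z + - 1 * g z) = \<pi> f + (- 1) *\<^sub>C \<pi> g"
    using functional_calculus_add[OF assms(1,2), of "\<lambda>z. - 1 * g z"]
      functional_calculus_scale[OF assms(1,3), of "- 1"] assms(3)
    by (simp add: continuous_intros)
  then show ?thesis by (simp add: scaleC_minus_left scaleC_one)
qed

lemma functional_calculus_poly: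
  assumes "is_functional_calculus a \<pi>"
  shows "\<pi> (poly p) = aeval a p"
proof (induction p)
  case 0
  have "\<pi> (\<lambda>z. 0) = 0 *\<^sub>C 1" by (rule functional_calculus_const[OF assms])
  moreover have "poly 0 = (\<lambda>z::complex. 0)" by auto
  ultimately show ?case by (simp add: aeval_0 scaleC_zero_left)
next
  case (pCons c p)
  have "\<pi> (poly (pCons c p)) = \<pi> (\<lambda>z. c) + \<pi> (\<lambda>z. z) * \<pi> (poly p)"
    unfolding poly_pCons_fun
    by (simp add: functional_calculus_add[OF assms] functional_calculus_mult[OF assms] continuous_intros)
  then show ?case
    by (simp only: functional_calculus_const[OF assms] functional_calculus_id[OF assms] aeval_pCons pCons.IH)
qed

text \<open>If \<open>f\<close> omits \<open>z\<close> on the spectrum, the image of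
  \<open>1 / (f - z)\<close> inverts \<open>\<pi> f - z\<close>.\<close>

lemma spectrum_functional_calculus:
  assumes "is_functional_calculus a \<pi>" "continuous_on (spectrum a) f"
  shows "spectrum (\<pi> f) \<subseteq> f ` spectrum a"
proof
  fix z assume z: "z \<in> spectrum (\<pi> f)"
  show "z \<in> f ` spectrum a"
  proof (rule ccontr)
    assume "z \<notin> f ` spectrum a"
    then have nz: "f w - z \<noteq> 0" if "w \<in> spectrum a" for w using that by auto
    let ?g = "\<lambda>w. f w - z" and ?h = "\<lambda>w. inverse (f w - z)"
    have cont: "continuous_on (spectrum a) ?g" "continuous_on (spectrum a) ?h"
      using assms(2) nz by (auto intro!: continuous_intros)
    have "\<pi> ?g = \<pi> f - z *\<^sub>C 1"
      using functional_calculus_diff[OF assms, of "\<lambda>_. z"] by (simp add: functional_calculus_const[OF assms(1)])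
    moreover have "\<pi> ?h * \<pi> ?g = \<pi> (\<lambda>w. 1)" "\<pi> ?g * \<pi> ?h = \<pi> (\<lambda>w. 1)"
      using cont nz unfolding functional_calculus_mult[OF assms(1) cont, symmetric]
        functional_calculus_mult[OF assms(1) cont(2,1), symmetric]
      by (auto intro!: functional_calculus_cong[OF assms(1)] continuous_intros)
    ultimately have "has_inverse (\<pi> f - z *\<^sub>C 1)"
      by (intro has_inverseI[of "\<pi> ?h"]) (simp_all add: functional_calculus_one[OF assms(1)])
    with z show False by (simp add: spectrum_iff)
  qed
qed

lemma cstar_positive_functional_calculus:
  assumes "is_functional_calculus a \<pi>" "continuous_on (spectrum a) f"
    "\<And>z. z \<in> spectrum a \<Longrightarrow> f z \<in> \<real>\<^sub>\<ge>\<^sub>0"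
  shows "cstar_positive (\<pi> f)"
  unfolding cstar_positive_def
proof
  have "star (\<pi> f) = \<pi> (\<lambda>z. cnj (f z))" by (rule functional_calculus_cnj[OF assms(1,2), symmetric])
  also have "\<dots> = \<pi> f"
  proof (rule functional_calculus_cong[OF assms(1)])
    show "cnj (f z) = f z" if "z \<in> spectrum a" for z
      using assms(3)[OF that] by (auto simp: Reals_cnj_iff nonneg_Reals_def)
  qed (use assms(2) in \<open>auto intro: continuous_intros\<close>)
  finally show "star (\<pi> f) = \<pi> f" .
  show "spectrum (\<pi> f) \<subseteq> \<real>\<^sub>\<ge>\<^sub>0" using spectrum_functional_calculus[OF assms(1,2)] assms(3) by auto
qed

text \<open>Contractivity follows from the algebraic conditions: the C*-identity passes to
  \<open>|f|^2\<close>, whose image is self-adjoint with spectrum among the values of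
  \<open>|f|^2\<close>.\<close>

lemma norm_functional_calculus_le:
  assumes "is_functional_calculus a \<pi>" "continuous_on (spectrum a) f"
    "\<And>z. z \<in> spectrum a \<Longrightarrow> cmod (f z) \<le> B" "0 \<le> B"
  shows "norm (\<pi> f) \<le> B"
proof -
  let ?g = "\<lambda>z. cnj (f z) * f z"
  have cont: "continuous_on (spectrum a) ?g" using assms(2) by (intro continuous_intros)
  have g: "\<pi> ?g = star (\<pi> f) * \<pi> f"
    using assms(2) by (simp add: functional_calculus_mult[OF assms(1)] functional_calculus_cnj[OF assms(1)] continuous_intros)
  have "norm (\<pi> ?g) \<le> B\<^sup>2"
  proof (rule norm_self_adjoint_le)
    show "star (\<pi> ?g) = \<pi> ?g" by (simp add: g star_mult star_star)
    fix z assume "z \<in> spectrum (\<pi> ?g)"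
    then obtain w where w: "w \<in> spectrum a" "z = cnj (f w) * f w"
      using spectrum_functional_calculus[OF assms(1) cont] by auto
    have "(cmod (f w))\<^sup>2 \<le> B\<^sup>2" using assms(3)[OF w(1)] by (rule power_mono) simp
    then show "cmod z \<le> B\<^sup>2" by (simp add: w(2) norm_mult power2_eq_square)
  qed simp
  then have "(norm (\<pi> f))\<^sup>2 \<le> B\<^sup>2" by (simp add: g norm_star_mult_self)
  then show ?thesis using assms(4) by (rule power2_le_imp_le)
qed

text \<open>Any functional calculus agrees with \<open>aeval a\<close> on polynomials, and
  contractivity carries this over to uniform limits. Uniqueness of the calculus on continuous
  functions results.\<close>

lemma calculus_limit_functional_calculus:
  assumes "spectrum a \<subseteq> \<real>" "is_functional_calculus a \<pi>" "continuous_on (spectrum a) f"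
  shows "calculus_limit a f (\<pi> f)"
proof -
  obtain p where p: "\<And>n z. z \<in> spectrum a \<Longrightarrow> cmod (poly (p n) z - f z) < 1 / real (Suc n)"
    using exists_poly_uniform_limit[OF assms(1,3)] by blast
  have "norm (aeval a (p n) - \<pi> f) \<le> 1 / real (Suc n)" for n
  proof -
    have "aeval a (p n) - \<pi> f = \<pi> (\<lambda>z. poly (p n) z - f z)"
      using functional_calculus_diff[OF assms(2) _ assms(3), of "poly (p n)"]
      by (simp add: functional_calculus_poly[OF assms(2)] continuous_intros)
    then show ?thesis
      using p assms(3) by (simp add: less_imp_le norm_functional_calculus_le[OF assms(2)] continuous_intros)
  qed
  then have "(\<lambda>n. aeval a (p n) - \<pi> f) \<longlonglongrightarrow> 0"
    by (intro Lim_null_comparison[OF always_eventually lim_1_over_n[THEN LIMSEQ_Suc]]) simp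
  then have "(\<lambda>n. aeval a (p n)) \<longlonglongrightarrow> \<pi> f" by (rule LIM_zero_cancel)
  then show ?thesis
    unfolding calculus_limit_def using uniform_limit_if_dist_less[of "spectrum a" "\<lambda>n. poly (p n)" f] p by blast
qed

lemma cfc_eq:
  assumes a: "star a = a" "spectrum a \<subseteq> \<real>" and "is_functional_calculus a \<pi>" "continuous_on (spectrum a) f"
  shows "cfc f a = \<pi> f"
  unfolding cfc_def
proof (rule the_equality)
  show "\<exists>\<pi>'. is_functional_calculus a \<pi>' \<and> \<pi>' f = \<pi> f" using assms by blast
  fix b assume "\<exists>\<pi>'. is_functional_calculus a \<pi>' \<and> \<pi>' f = b"
  then obtain \<pi>' where "is_functional_calculus a \<pi>'" "\<pi>' f = b" by blast
  then show "b = \<pi> f"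
    using calculus_limit_unique[OF a calculus_limit_functional_calculus calculus_limit_functional_calculus]
      assms by blast
qed

section \<open>The inequality for positive maps\<close>

lemma nonneg_powr_mult:
  assumes "0 \<le> a" "0 \<le> b" "0 \<le> x"
  shows "nonneg_powr (a * b) x = nonneg_powr a (nonneg_powr b x)"
  using assms by (auto simp: nonneg_powr_def powr_powr mult.commute)

lemma nonneg_powr_nonneg: "0 \<le> nonneg_powr a x"
  by (simp add: nonneg_powr_def)

lemma nonneg_powr_scale:
  assumes "0 < c" "0 \<le> y"
  shows "nonneg_powr a (c * y) = c powr a * nonneg_powr a y"
  using assms by (simp add: nonneg_powr_def powr_mult)

lemma continuous_on_nonneg_powr:
  assumes "continuous_on S f" "\<And>x. x \<in> S \<Longrightarrow> 0 \<le> f x" "0 \<le> a"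
  shows "continuous_on S (\<lambda>x. nonneg_powr a (f x))"
  using assms by (cases "a = 0") (auto simp: nonneg_powr_def intro!: continuous_on_powr' continuous_on_const)

text \<open>Convexity of the exponential function between 0 and \<open>ln y\<close>.\<close>

lemma nonneg_powr_le_affine:
  assumes "0 \<le> a" "a \<le> 1" "0 \<le> y"
  shows "nonneg_powr a y \<le> a * y + (1 - a)"
proof (cases "a = 0 \<or> y = 0")
  case True
  then show ?thesis using assms by (auto simp: nonneg_powr_def)
next
  case False
  then have y: "0 < y" "a \<noteq> 0" using assms by auto
  have "exp ((1 - a) *\<^sub>R 0 + a *\<^sub>R ln y) \<le> (1 - a) * exp 0 + a * exp (ln y)"
    using assms by (intro convex_onD[OF exp_convex]) auto
  then show ?thesis using y by (simp add: nonneg_powr_def powr_def)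
qed

text \<open>The preceding inequality with exponent \<open>1 / m\<close>, at the point
  \<open>y^m\<close>.\<close>

lemma nonneg_powr_ge_affine:
  assumes "1 \<le> m" "0 \<le> y"
  shows "m * y - (m - 1) \<le> nonneg_powr m y"
proof -
  have "y = nonneg_powr (1 / m) (nonneg_powr m y)"
    using assms nonneg_powr_mult[of "1 / m" m y] by (simp add: nonneg_powr_one)
  also have "\<dots> \<le> 1 / m * nonneg_powr m y + (1 - 1 / m)"
    using assms by (intro nonneg_powr_le_affine nonneg_powr_nonneg) auto
  finally show ?thesis using assms by (simp add: field_simps)
qed

lemma mat_scale_of_real: "mat_scale (complex_of_real c) M = c *\<^sub>R M"
  by (simp add: mat_scale_def vec_eq_iff scaleR_conv_of_real[where 'a = complex])

theorem proposition1p4: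
  fixes \<Phi> :: "'a::cstar_algebra \<Rightarrow> complex^'n^'n"
    and A :: 'a
    and p q r :: real
  assumes "positive_linear_map \<Phi>"
    and "sub_unital \<Phi>"
    and "cstar_positive A"
    and "p \<ge> 0" and "q \<ge> 0" and "r \<ge> 0"
    and "q \<ge> p" and "q \<ge> r"
  shows "\<exists>U V :: complex^'n^'n. unitary U \<and> unitary V \<and>
    mat_abs (\<Phi> (cstar_powr A p) ** \<Phi> (cstar_powr A q) ** \<Phi> (cstar_powr A r)) \<preceq>
      (1/2) *\<^sub>R (U ** \<Phi> (cstar_powr A (p + q + r)) ** conj_transpose U
               + V ** \<Phi> (cstar_powr A (p + q + r)) ** conj_transpose V)"
proof -
  interpret \<Phi>: Vector_Spaces.linear scaleC mat_scale \<Phi>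
    using assms(1) by (simp add: positive_linear_map_def)
  have \<Phi>_psd: "psd (\<Phi> x)" if "cstar_positive x" for x
    using assms(1) that by (simp add: positive_linear_map_def)
  have A: "star A = A" "spectrum A \<subseteq> \<real>" "spectrum A \<subseteq> \<real>\<^sub>\<ge>\<^sub>0"
    using assms(3) nonneg_Reals_subset_Reals by (auto simp: cstar_positive_def)
  obtain \<pi> where \<pi>: "is_functional_calculus A \<pi>"
    using functional_calculus_exists[OF A(1,2)] by blast
  define \<pi>\<^sub>R where "\<pi>\<^sub>R = (\<lambda>g. \<pi> (\<lambda>z. complex_of_real (g z)))"
  \<comment> \<open>For fixed \<open>h\<close> this is a positive linear functional on the real
    continuous functions on the spectrum, with value at most \<open>|h|^2\<close> at the function 1.
    It turns scalar inequalities on the spectrum into inequalities of quadratic forms.\<close>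
  define L where "L = (\<lambda>h g. h \<bullet> (\<Phi> (\<pi>\<^sub>R g) *v h))"
  define C where "C = {g :: complex \<Rightarrow> real. continuous_on (spectrum A) g}"
  have C_const: "(\<lambda>z. c) \<in> C" for c by (simp add: C_def)
  have C_scale: "(\<lambda>z. c * g z) \<in> C" if "g \<in> C" for c g
    using that by (auto simp: C_def intro: continuous_intros)
  have C_add: "(\<lambda>z. f z + g z) \<in> C" if "f \<in> C" "g \<in> C" for f g
    using that by (auto simp: C_def intro: continuous_intros)
  have C_of_real: "continuous_on (spectrum A) (\<lambda>z. complex_of_real (g z))" if "g \<in> C" for g
    using that by (auto simp: C_def intro: continuous_intros)
  have L_add: "L h (\<lambda>z. f z + g z) = L h f + L h g" if "f \<in> C" "g \<in> C" for f g h
    using functional_calculus_add[OF \<pi> C_of_real[OF that(1)] C_of_real[OF that(2)]]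
    by (simp add: L_def \<pi>\<^sub>R_def \<Phi>.add matrix_vector_mult_add_rdistrib inner_add_right)
  have L_scale: "L h (\<lambda>z. c * g z) = c * L h g" if "g \<in> C" for c g h
    using functional_calculus_scale[OF \<pi> C_of_real[OF that], of "complex_of_real c"]
    by (simp add: L_def \<pi>\<^sub>R_def \<Phi>.scale mat_scale_of_real scaleR_matrix_vector_mult)
  have psd_\<pi>: "psd (\<Phi> (\<pi>\<^sub>R g))" if "g \<in> C" "\<And>z. z \<in> spectrum A \<Longrightarrow> 0 \<le> g z" for g
    unfolding \<pi>\<^sub>R_def using that
    by (intro \<Phi>_psd cstar_positive_functional_calculus[OF \<pi>] C_of_real) (simp_all add: nonneg_Reals_of_real_iff)
  have L_mono: "L h f \<le> L h g" if "f \<in> C" "g \<in> C" "\<And>z. z \<in> spectrum A \<Longrightarrow> f z \<le> g z" for f g h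
  proof -
    have "0 \<le> L h (\<lambda>z. g z + - 1 * f z)"
      using psd_\<pi>[OF C_add[OF that(2) C_scale[OF that(1)]], of "- 1"] that(3)
      unfolding L_def psd_iff by fastforce
    then show ?thesis
      using L_add[OF that(2) C_scale[OF that(1)], of h "- 1"] L_scale[OF that(1), of h "- 1"] by linarith
  qed
  \<comment> \<open>Sub-unitality of \<Phi> enters here.\<close>
  have L_one: "L h (\<lambda>z. 1) \<le> (norm h)\<^sup>2" for h
  proof -
    have "0 \<le> h \<bullet> ((mat 1 - \<Phi> 1) *v h)"
      using assms(2) unfolding sub_unital_def loewner_le_def psd_iff by blast
    then show ?thesis
      by (simp add: L_def \<pi>\<^sub>R_def functional_calculus_one[OF \<pi>] matrix_vector_mult_diff_rdistrib
          inner_diff_right power2_norm_eq_inner)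
  qed
  define pw where "pw = (\<lambda>t z. nonneg_powr t (Re z))"
  have Re_nonneg: "0 \<le> Re z" if "z \<in> spectrum A" for z
    using A(3) that by (auto simp: complex_nonneg_Reals_iff)
  have pw_C: "pw t \<in> C" if "0 \<le> t" for t
    unfolding C_def pw_def using that Re_nonneg by (auto intro!: continuous_on_nonneg_powr continuous_intros)
  have powr_eq: "cstar_powr A t = \<pi>\<^sub>R (pw t)" if "0 \<le> t" for t
    unfolding cstar_powr_def \<pi>\<^sub>R_def using cfc_eq[OF A(1,2) \<pi> C_of_real[OF pw_C[OF that]]]
    by (simp add: pw_def)
  have psd_pw: "psd (\<Phi> (\<pi>\<^sub>R (pw t)))" if "0 \<le> t" for t
    using pw_C[OF that] by (intro psd_\<pi>) (simp_all add: pw_def nonneg_powr_nonneg)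
  have upper: "h \<bullet> (\<Phi> (\<pi>\<^sub>R (pw t)) *v h)
      \<le> c powr a * (a * (h \<bullet> (\<Phi> (\<pi>\<^sub>R (pw q)) *v h)) / c + (1 - a) * (norm h)\<^sup>2)"
    if "0 < c" "0 \<le> a" "a \<le> 1" "t = a * q" for a c t h
  proof -
    have t: "0 \<le> t" using that assms(5) by simp
    \<comment> \<open>The trailing factor 1 presents the constant as a multiple of the function 1,
      in the form required by \<open>L_scale\<close>.\<close>
    have "pw t z \<le> c powr a * a / c * pw q z + c powr a * (1 - a) * 1" if z: "z \<in> spectrum A" for z
    proof -
      define u where "u = pw q z"
      have u: "0 \<le> u" by (simp add: u_def pw_def nonneg_powr_nonneg)
      \<comment> \<open>Since \<open>t = a q\<close>, the power \<open>t\<close> is the power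
        \<open>a\<close> of \<open>u\<close>; rescaling by \<open>c\<close> reduces to the tangent
        line at 1.\<close>
      have "pw t z = nonneg_powr a (c * (u / c))"
        using \<open>0 < c\<close> \<open>0 \<le> a\<close> assms(5) Re_nonneg[OF z]
        by (simp add: \<open>t = a * q\<close> u_def pw_def nonneg_powr_mult)
      also have "\<dots> = c powr a * nonneg_powr a (u / c)"
        using \<open>0 < c\<close> u by (intro nonneg_powr_scale) auto
      also have "\<dots> \<le> c powr a * (a * (u / c) + (1 - a))"
        using \<open>0 < c\<close> \<open>0 \<le> a\<close> \<open>a \<le> 1\<close> u by (intro mult_left_mono nonneg_powr_le_affine) auto
      finally show ?thesis by (simp add: u_def algebra_simps)
    qed
    then have "L h (pw t) \<le> L h (\<lambda>z. c powr a * a / c * pw q z + c powr a * (1 - a) * 1)"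
      by (intro L_mono pw_C C_add C_scale C_const t assms(5))
    also have "\<dots> = c powr a * a / c * L h (pw q) + c powr a * (1 - a) * L h (\<lambda>z. 1)"
      by (simp only: L_add L_scale C_scale pw_C C_const assms(5))
    \<comment> \<open>The constant term has the nonnegative factor \<open>1 - a\<close>, so the
      bound on the value at 1 acts in the right direction.\<close>
    also have "\<dots> \<le> c powr a * a / c * L h (pw q) + c powr a * (1 - a) * (norm h)\<^sup>2"
      using that L_one by (intro add_left_mono mult_left_mono) auto
    finally show ?thesis unfolding L_def by (simp add: algebra_simps)
  qed
  have lower: "c powr m * (m * (h \<bullet> (\<Phi> (\<pi>\<^sub>R (pw q)) *v h)) / c - (m - 1) * (norm h)\<^sup>2)
      \<le> h \<bullet> (\<Phi> (\<pi>\<^sub>R (pw t)) *v h)"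
    if "0 < c" "1 \<le> m" "t = m * q" for m c t h
  proof -
    have t: "0 \<le> t" using that assms(5) by simp
    have "c powr m * m / c * pw q z + - (c powr m * (m - 1)) * 1 \<le> pw t z" if z: "z \<in> spectrum A" for z
    proof -
      define u where "u = pw q z"
      have u: "0 \<le> u" by (simp add: u_def pw_def nonneg_powr_nonneg)
      have "pw t z = nonneg_powr m (c * (u / c))"
        using \<open>0 < c\<close> \<open>1 \<le> m\<close> assms(5) Re_nonneg[OF z]
        by (simp add: \<open>t = m * q\<close> u_def pw_def nonneg_powr_mult)
      also have "\<dots> = c powr m * nonneg_powr m (u / c)"
        using \<open>0 < c\<close> u by (intro nonneg_powr_scale) auto
      also have "\<dots> \<ge> c powr m * (m * (u / c) - (m - 1))"
        using \<open>0 < c\<close> \<open>1 \<le> m\<close> u by (intro mult_left_mono nonneg_powr_ge_affine) auto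
      finally show ?thesis by (simp add: u_def algebra_simps)
    qed
    then have "L h (\<lambda>z. c powr m * m / c * pw q z + - (c powr m * (m - 1)) * 1) \<le> L h (pw t)"
      by (intro L_mono pw_C C_add C_scale C_const t assms(5))
    moreover have "L h (\<lambda>z. c powr m * m / c * pw q z + - (c powr m * (m - 1)) * 1) =
        c powr m * m / c * L h (pw q) + - (c powr m * (m - 1)) * L h (\<lambda>z. 1)"
      by (simp only: L_add L_scale C_scale pw_C C_const assms(5))
    \<comment> \<open>Here the constant term is subtracted with a nonnegative factor, so an upper
      bound on the value at 1 is again what is needed.\<close>
    moreover have "c powr m * (m - 1) * L h (\<lambda>z. 1) \<le> c powr m * (m - 1) * (norm h)\<^sup>2"
      using that L_one by (intro mult_left_mono) auto
    ultimately have "c powr m * m / c * L h (pw q) - c powr m * (m - 1) * (norm h)\<^sup>2 \<le> L h (pw t)"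
      unfolding mult_minus_left by linarith
    then show ?thesis unfolding L_def by (simp add: algebra_simps)
  qed
  \<comment> \<open>For \<open>q = 0\<close> also \<open>p = r = 0\<close>, and since division by
    zero gives 0, the equations \<open>p = \<alpha> q\<close> and \<open>r = \<beta> q\<close>
    remain valid.\<close>
  define \<alpha> where "\<alpha> = p / q"
  define \<beta> where "\<beta> = r / q"
  have \<alpha>: "0 \<le> \<alpha>" "\<alpha> \<le> 1" "p = \<alpha> * q" and \<beta>: "0 \<le> \<beta>" "\<beta> \<le> 1" "r = \<beta> * q"
    using assms(4-8) by (auto simp: \<alpha>_def \<beta>_def divide_le_eq)
  have m: "1 \<le> 1 + \<alpha> + \<beta>" "p + q + r = (1 + \<alpha> + \<beta>) * q"
    using \<alpha> \<beta> by (simp_all add: algebra_simps)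
  show ?thesis
    unfolding powr_eq[OF assms(4)] powr_eq[OF assms(5)] powr_eq[OF assms(6)]
      powr_eq[OF add_nonneg_nonneg[OF add_nonneg_nonneg[OF assms(4,5)] assms(6)]]
    using assms(4-6)
    by (intro mat_abs_triple_product_le[OF _ _ _ _ \<alpha>(1,2) \<beta>(1,2)] psd_pw upper lower \<alpha> \<beta> m) auto
qed

end
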